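(* Let $R=E-P$ and $\widetilde R=E-\widetilde P$, where $P$ and $\widetilde P$ are nonnegative $J\times J$ matrices with spectral radius less than one and zeros on the diagonal. Let $(x,\chi)\in C^J\times C^{J\times J}$ with $\chi$ componentwise nonnegative and nondecreasing. Then the augmented Skorohod problem associated with $(R,\widetilde R)$ for $(x,\chi)$ has a unique solution, i.e. there is exactly one $(z,y,a,b)$ that satisfies it.
   Context: $E$ is the $J\times J$ identity matrix; for a matrix $M$, $M^j$ is its $j$th column and $M_i$ its $i$th row. $C^J$, $C_+^J$, $C^{J\times J}$ are the continuous functions on $\mathbb{R}_+=[0,\infty)$ with values in $\mathbb{R}^J$, $\mathbb{R}_+^J$ and the real $J\times J$ matrices, respectively; $\mathbb{D}_+^{J\times J}$ is the space of right-continuous functions on $\mathbb{R}_+$ with left limits and values in the entrywise nonnegative $J\times J$ matrices. For vector-valued functions, $\int v(t)\,dw(t)=\sum_i\int v_i(t)\,dw_i(t)$. Augmented Skorohod problem: $(z,y,a,b)\in C_+^J\times C_+^J\times\mathbb{D}_+^{J\times J}\times\mathbb{D}_+^{J\times J}$ satisfies the augmented Skorohod problem associated with $(R,\widetilde R)$ for $(x,\chi)$ if: (1) $z(t)=x(t)+Ry(t)$ for $t\ge0$; (2) $y(0)=0$, $y$ is componentwise nondecreasing and $\int_0^\infty z(t)\,dy(t)=0$; (3) $a(t)=\chi(t)-\widetilde R\,b(t)$ for $t\ge0$; (4) $b(0)=0$, $b(t)\ge0$, $b$ is componentwise nondecreasing and $\int_0^\infty z(t)\,db^j(t)=0$ for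 $j=1,\dots,J$; (5) for $i=1,\dots,J$ and $t\ge0$, $z_i(t)=0$ implies $a_i(t)=0$ (the $i$th row of $a(t)$ vanishes).
   Formalization: The formal theorem adds x(0) ≥ 0 and that row i of χ(0) vanishes whenever x_i(0) = 0; both are necessary for a solution to exist (J = 1, P = P̃ = 0, x = 0, χ = 1 has none). *)

theory Defs
  imports "HOL-Analysis.Analysis"
begin

(* Functions on [0,oo) are total functions on the reals that are extensional
   on {0..}, so that equality of functions means equality on [0,oo). *)

definition continuous_paths :: "'a::topological_space set \<Rightarrow> (real \<Rightarrow> 'a) set" where
  "continuous_paths S = {f \<in> {0..} \<rightarrow>\<^sub>E S. continuous_on {0..} f}"

definition cadlag_paths :: "'a::t2_space set \<Rightarrow> (real \<Rightarrow> 'a) set" where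
  "cadlag_paths S = {f \<in> {0..} \<rightarrow>\<^sub>E S.
     (\<forall>t\<ge>0. continuous (at_right t) f) \<and> (\<forall>t>0. \<exists>l. (f \<longlongrightarrow> l) (at_left t))}"

definition matrix_spectral_radius :: "real^'n^'n \<Rightarrow> real" where
  "matrix_spectral_radius M =
     Sup {cmod l | l. \<exists>v. v \<noteq> 0 \<and> (\<chi> i j. complex_of_real (M $ i $ j)) *v v = l *s v}"

(* The Lebesgue-Stieltjes integral over [0,oo) of a nonnegative v against a
   nondecreasing right-continuous w; no mass is placed at time 0.  It takes values in
   [0,oo], so a divergent integral is not 0 (as it would be for the Bochner integral). *)

definition stieltjes_integral :: "(real \<Rightarrow> real^'n) \<Rightarrow> (real \<Rightarrow> real^'n) \<Rightarrow> ennreal" where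
  "stieltjes_integral v w =
     (\<Sum>i\<in>UNIV. \<integral>\<^sup>+ t\<in>{0..}. ennreal (v t $ i) \<partial>interval_measure (\<lambda>s. w (max 0 s) $ i))"

(* The library's order on vectors and matrices is the entrywise one, so {0..} is the
   nonnegative orthant (resp. the nonnegative matrices) and mono_on is componentwise. *)

definition augmented_skorohod ::
  "real^'n^'n \<Rightarrow> real^'n^'n \<Rightarrow> (real \<Rightarrow> real^'n) \<Rightarrow> (real \<Rightarrow> real^'n^'n) \<Rightarrow>
   (real \<Rightarrow> real^'n) \<times> (real \<Rightarrow> real^'n) \<times> (real \<Rightarrow> real^'n^'n) \<times> (real \<Rightarrow> real^'n^'n) \<Rightarrow> bool"
where
  "augmented_skorohod R R' x chi = (\<lambda>(z, y, a, b).
     z \<in> continuous_paths {0..} \<and> y \<in> continuous_paths {0..} \<and>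
     a \<in> cadlag_paths {0..} \<and> b \<in> cadlag_paths {0..} \<and>
     (\<forall>t\<ge>0. z t = x t + R *v y t) \<and>
     y 0 = 0 \<and> mono_on {0..} y \<and> stieltjes_integral z y = 0 \<and>
     (\<forall>t\<ge>0. a t = chi t - R' ** b t) \<and>
     b 0 = 0 \<and> (\<forall>t\<ge>0. 0 \<le> b t) \<and> mono_on {0..} b \<and>
       (\<forall>j. stieltjes_integral z (\<lambda>t. column j (b t)) = 0) \<and>
     (\<forall>i. \<forall>t\<ge>0. z t $ i = 0 \<longrightarrow> row i (a t) = 0))"

(* A solution has z(0) = x(0) and a(0) = chi(0); hence the following compatibility
   conditions at time 0 are necessary for solvability. *)

lemma augmented_skorohod_initial:
  assumes "augmented_skorohod R R' x chi s"
  shows "0 \<le> x 0" and "x 0 $ i = 0 \<Longrightarrow> row i (chi 0) = 0"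
proof -
  obtain z y a b where s: "s = (z, y, a, b)"
    by (cases s) auto
  note sol = assms[unfolded s augmented_skorohod_def prod.case]
  have z0: "z 0 = x 0" and a0: "a 0 = chi 0"
    using sol by (simp_all add: matrix_vector_mult_0_right)
  have "z \<in> {0..} \<rightarrow> {0..}"
    using sol by (auto simp: continuous_paths_def PiE_def)
  then have "z 0 \<in> {0..}"
    by (rule funcset_mem) simp
  then show "0 \<le> x 0"
    by (simp add: z0)
  show "row i (chi 0) = 0" if "x 0 $ i = 0"
    using sol that z0 a0 by (metis order_refl)
qed

end

theory Submission
  imports Defs
begin

text \<open>
  The problem is solved in two stages. The pair \<open>(z, y)\<close> is the solution of the usual
  (oblique) Skorohod problem, which does not involve \<open>a\<close> and \<open>b\<close>; then \<open>z\<close> is a known path, and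
  each column of \<open>b\<close> is found separately (\<open>augmented_skorohod_iff\<close>).

  In both stages a vanishing Stieltjes integral means that the integrator does not move during
  an excursion of \<open>z\<^sub>i\<close> away from \<open>0\<close> (\<open>stieltjes_integral_eq_0_iff\<close>), so the integrator at time
  \<open>t\<close> equals its value at the last zero of \<open>z\<^sub>i\<close> before \<open>t\<close>. In the first stage this shows that
  \<open>y\<^sub>i\<close> is the running maximum of the positive part of \<open>(P y)\<^sub>i - x\<^sub>i\<close>
  (\<open>skorohod_problem_iff_fixpoint\<close>). In the second stage the vanishing of row \<open>i\<close> of
  \<open>a = \<chi> + P' b - b\<close> at the zeros of \<open>z\<^sub>i\<close> says that \<open>b\<^sub>i(t)\<close> is the value of
  \<open>\<chi>\<^sub>i + (P' b)\<^sub>i\<close> at the last zero of \<open>z\<^sub>i\<close> before \<open>t\<close>, and \<open>0\<close> if there is none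
  (\<open>excursion_problem_iff_fixpoint\<close>).

  Thus both stages are fixed point equations. Running maximum and value at the last zero are
  nonexpansive for the supremum over \<open>[0,t]\<close>, and the matrices \<open>P\<close> and \<open>P'\<close> are strict
  contractions for suitably weighted maximum norms, because their spectral radius is less than
  one (\<open>exists_contracted_weight\<close>). Picard iteration gives existence and uniqueness
  (\<open>weighted_contraction_fixpoint_exists\<close>, \<open>weighted_contraction_fixpoint_unique\<close>), the first in
  the class of continuous paths, the second in the class of nondecreasing right-continuous ones.
\<close>

section \<open>Weights contracted by a nonnegative matrix\<close>

text \<open>By Cramer's rule the solution is a rational function of \<open>t\<close>.\<close>

lemma cramer_solution_continuous:
  fixes P :: "real^'n^'n"
  assumes "\<And>t. t \<in> S \<Longrightarrow> det (mat 1 - t *\<^sub>R P) \<noteq> 0"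
  shows "\<exists>w. continuous_on S w \<and> (\<forall>t\<in>S. (mat 1 - t *\<^sub>R P) *v w t = v)"
proof -
  define A where "A t = mat 1 - t *\<^sub>R P" for t
  define w where "w t = (\<chi> k. det (\<chi> i j. if j = k then v $ i else A t $ i $ j) / det (A t))" for t
  have entry: "continuous_on S (\<lambda>t. A t $ i $ j)" for i j
    unfolding A_def vector_minus_component vector_scaleR_component
    by (intro continuous_intros)
  have num: "continuous_on S (\<lambda>t. if j = k then v $ i else A t $ i $ j)" for i j k
    by (cases "j = k") (auto intro: entry)
  have "continuous_on S w"
    unfolding w_def
    apply (intro continuous_on_vec_lambda continuous_on_divide)
    subgoal unfolding det_def
      by (simp only: vec_lambda_beta) (intro continuous_intros num)
    subgoal unfolding det_def by (intro continuous_intros entry)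
    subgoal using assms by (auto simp: A_def)
    done
  moreover have "A t *v w t = v" if "t \<in> S" for t
    using assms[OF that, folded A_def] unfolding w_def by (subst cramer) simp_all
  ultimately show ?thesis unfolding A_def by blast
qed

text \<open>
  Without boundedness the supremum that defines the spectral radius would say nothing about the
  individual eigenvalues. The bound comes from a coordinate where the eigenvector is largest.
\<close>

lemma bdd_above_eigenvalue_moduli:
  fixes M :: "real^'n^'n"
  shows "bdd_above {cmod l | l. \<exists>v. v \<noteq> 0 \<and> (\<chi> i j. complex_of_real (M $ i $ j)) *v v = l *s v}"
proof (rule bdd_aboveI)
  fix r assume "r \<in> {cmod l | l. \<exists>v. v \<noteq> 0 \<and> (\<chi> i j. complex_of_real (M $ i $ j)) *v v = l *s v}"
  then obtain l v where r: "r = cmod l" and v: "v \<noteq> 0"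
    and eig: "(\<chi> i j. complex_of_real (M $ i $ j)) *v v = l *s v" by blast
  define m where "m = Max (range (\<lambda>i. cmod (v $ i)))"
  have le_m: "cmod (v $ i) \<le> m" for i unfolding m_def by simp
  have "m \<in> range (\<lambda>i. cmod (v $ i))" unfolding m_def by (rule Max_in) auto
  then obtain k where k: "cmod (v $ k) = m" by auto
  obtain i where "v $ i \<noteq> 0" using v by (auto simp: vec_eq_iff)
  then have "0 < m" using le_m[of i] by (meson less_le_trans zero_less_norm_iff)
  have "cmod l * m = cmod (\<Sum>j\<in>UNIV. complex_of_real (M $ k $ j) * v $ j)"
    using arg_cong[OF eig, of "\<lambda>w. cmod (w $ k)"] by (simp add: matrix_vector_mult_def norm_mult k)
  also have "\<dots> \<le> (\<Sum>j\<in>UNIV. \<bar>M $ k $ j\<bar> * cmod (v $ j))"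
    by (rule order_trans[OF norm_sum]) (simp add: norm_mult)
  also have "\<dots> \<le> (\<Sum>j\<in>UNIV. \<bar>M $ k $ j\<bar> * m)"
    by (intro sum_mono mult_left_mono le_m) auto
  also have "\<dots> = (\<Sum>j\<in>UNIV. \<bar>M $ k $ j\<bar>) * m" by (simp add: sum_distrib_right)
  finally have "cmod l \<le> (\<Sum>j\<in>UNIV. \<bar>M $ k $ j\<bar>)" using \<open>0 < m\<close> by simp
  also have "\<dots> \<le> (\<Sum>i\<in>UNIV. \<Sum>j\<in>UNIV. \<bar>M $ i $ j\<bar>)"
    by (rule member_le_sum) (auto intro: sum_nonneg)
  finally show "r \<le> (\<Sum>i\<in>UNIV. \<Sum>j\<in>UNIV. \<bar>M $ i $ j\<bar>)" using r by simp
qed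

text \<open>
  A real kernel vector would be an eigenvector of \<open>P\<close> for \<open>1 / t \<ge> 1\<close>.
\<close>

lemma det_nonzero_below_spectral_radius:
  fixes P :: "real^'n^'n"
  assumes "matrix_spectral_radius P < 1" "0 \<le> t" "t \<le> 1"
  shows "det (mat 1 - t *\<^sub>R P) \<noteq> 0"
proof
  assume "det (mat 1 - t *\<^sub>R P) = 0"
  then have "\<not> invertible (mat 1 - t *\<^sub>R P)" by (simp add: invertible_det_nz)
  then obtain v where v: "v \<noteq> 0" "(mat 1 - t *\<^sub>R P) *v v = 0"
    by (metis invertible_left_inverse matrix_left_invertible_ker)
  then have tv: "t *\<^sub>R (P *v v) = v"
    by (simp add: matrix_vector_mult_diff_rdistrib scaleR_matrix_vector_assoc)
  then have "t > 0" using v assms by (cases "t = 0") auto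
  define l where "l = complex_of_real (1 / t)"
  define w where "w = (\<chi> i. complex_of_real (v $ i))"
  have Pv: "(P *v v) $ i = v $ i / t" for i
    using arg_cong[OF tv, of "\<lambda>x. x $ i"] \<open>t > 0\<close> by (simp add: field_simps)
  have "(\<chi> i j. complex_of_real (P $ i $ j)) *v w = l *s w"
  proof (simp add: vec_eq_iff, intro allI)
    fix i
    have "((\<chi> i j. complex_of_real (P $ i $ j)) *v w) $ i = complex_of_real ((P *v v) $ i)"
      by (simp add: matrix_vector_mult_def w_def)
    then show "((\<chi> i j. complex_of_real (P $ i $ j)) *v w) $ i = l * w $ i"
      unfolding Pv by (simp add: l_def w_def)
  qed
  moreover have "w \<noteq> 0" using v by (simp add: w_def vec_eq_iff)
  ultimately have "cmod l \<le> matrix_spectral_radius P"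
    unfolding matrix_spectral_radius_def
    by (intro cSup_upper[OF _ bdd_above_eigenvalue_moduli]) blast
  moreover have "1 \<le> cmod l" using \<open>t > 0\<close> assms by (simp add: l_def norm_divide)
  ultimately show False using assms by simp
qed

lemma matrix_vector_mono:
  fixes P :: "real^'n^'n"
  assumes "0 \<le> P" "\<And>j. v $ j \<le> w $ j"
  shows "(P *v v) $ i \<le> (P *v w) $ i"
  unfolding matrix_vector_mult_def using assms
  by (auto intro!: sum_mono mult_left_mono simp: less_eq_vec_def)

text \<open>
  The spectral radius enters the whole proof only through the weight \<open>u\<close>, which makes \<open>P\<close> a
  strict contraction for the norm \<open>max\<^sub>i \<bar>v\<^sub>i\<bar> / u\<^sub>i\<close>. This \<open>u\<close> is the solution of
  \<open>(1 - P) u = (1, \<dots>, 1)\<close>, and its positivity is obtained by deforming \<open>P\<close> to \<open>0\<close>: let \<open>w(t)\<close> solve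
  \<open>w = 1 + t P w\<close>. If \<open>w(t)\<close> is nonnegative, then this equation makes it at least \<open>1\<close>, so that
  being nonnegative is a closed and open condition on \<open>t \<in> [0,1]\<close>, and it holds at \<open>t = 0\<close>.
\<close>

lemma exists_contracted_weight:
  fixes P :: "real^'n^'n"
  assumes "0 \<le> P" and "matrix_spectral_radius P < 1"
  obtains u \<theta> where "\<And>i. 0 < u $ i" "0 \<le> \<theta>" "\<theta> < 1" "\<And>i. (P *v u) $ i \<le> \<theta> * u $ i"
proof -
  obtain w where w: "continuous_on {0..1} w"
    and eq: "\<And>t. t \<in> {0..1} \<Longrightarrow> (mat 1 - t *\<^sub>R P) *v w t = 1"
    using cramer_solution_continuous[of "{0..1}" P 1] det_nonzero_below_spectral_radius[OF assms(2)]
    by (metis atLeastAtMost_iff)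
  have expand: "w t $ i = 1 + t * (P *v w t) $ i" if "t \<in> {0..1}" for t i
    using arg_cong[OF eq[OF that], of "\<lambda>x. x $ i"]
    by (simp add: matrix_vector_mult_diff_rdistrib scaleR_matrix_vector_assoc[symmetric])
  have ge1: "1 \<le> w t $ i" if t: "t \<in> {0..1}" and nn: "\<And>j. 0 \<le> w t $ j" for t i
  proof -
    have "(P *v 0) $ i \<le> (P *v w t) $ i" by (rule matrix_vector_mono[OF assms(1)]) (simp add: nn)
    then show ?thesis using expand[OF t, of i] t by simp
  qed
  define T where "T = {t \<in> {0..1}. \<forall>i. 0 \<le> w t $ i}"
  have "T = {0..1} \<inter> w -` {v. \<forall>i. 0 \<le> v $ i}" by (auto simp: T_def)
  moreover have "closed {v :: real^'n. \<forall>i. 0 \<le> v $ i}"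
    by (intro closed_Collect_all closed_Collect_le continuous_intros)
  ultimately have cl: "closedin (top_of_set {0..1}) T"
    using continuous_closedin_preimage[OF w] by metis
  \<comment> \<open>the same set, now as the preimage of an open set\<close>
  have "T = {0..1} \<inter> w -` {v. \<forall>i. 0 < v $ i}"
    using ge1 unfolding T_def by (force intro: less_imp_le less_le_trans[OF zero_less_one])
  moreover have "open {v :: real^'n. \<forall>i. 0 < v $ i}"
    by (simp add: Collect_all_eq) (intro open_INT ballI open_Collect_less continuous_intros finite)
  ultimately have op: "openin (top_of_set {0..1}) T"
    using continuous_openin_preimage_gen[OF w] by metis
  have "0 \<in> T" using expand[of 0] by (simp add: T_def)
  then have "T = {0..1}"
    using connected_clopen[of "{0..1::real}"] cl op by auto
  then have pos: "1 \<le> w 1 $ i" for i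
    using ge1[of 1] unfolding T_def set_eq_iff mem_Collect_eq by (metis atLeastAtMost_iff order_refl zero_le_one)
  \<comment> \<open>since \<open>P w = w - 1\<close>, any \<open>m \<ge> w\<^sub>i\<close> gives the factor \<open>1 - 1 / m\<close>\<close>
  define m where "m = (\<Sum>i\<in>UNIV. w 1 $ i)"
  have le_m: "w 1 $ i \<le> m" for i
    unfolding m_def using pos by (intro member_le_sum) (auto intro: order_trans[OF zero_le_one])
  have m: "1 \<le> m" using pos le_m order_trans by blast
  show ?thesis
  proof
    show "0 < w 1 $ i" for i using pos[of i] by simp
    show "0 \<le> 1 - 1 / m" "1 - 1 / m < 1" using m by auto
    show "(P *v w 1) $ i \<le> (1 - 1 / m) * w 1 $ i" for i
      using expand[of 1 i] le_m[of i] m by (simp add: field_simps)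
  qed
qed

lemma weighted_contraction:
  fixes P :: "real^'n^'n"
  assumes P: "0 \<le> P" and contr: "(P *v u) $ i \<le> \<theta> * u $ i" and "0 \<le> c"
    and vw: "\<And>j. \<bar>v $ j - w $ j\<bar> \<le> c * u $ j"
  shows "\<bar>(P *v v) $ i - (P *v w) $ i\<bar> \<le> \<theta> * c * u $ i"
proof -
  have "\<bar>(P *v v) $ i - (P *v w) $ i\<bar> = \<bar>\<Sum>j\<in>UNIV. P $ i $ j * (v $ j - w $ j)\<bar>"
    by (simp add: matrix_vector_mult_def sum_subtractf right_diff_distrib)
  also have "\<dots> \<le> (\<Sum>j\<in>UNIV. P $ i $ j * (c * u $ j))"
    using P vw by (intro order_trans[OF sum_abs] sum_mono)
      (auto simp: abs_mult less_eq_vec_def intro!: mult_mono)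
  also have "\<dots> = c * (P *v u) $ i"
    by (simp add: matrix_vector_mult_def sum_distrib_left mult_ac)
  also have "\<dots> \<le> c * (\<theta> * u $ i)" using contr \<open>0 \<le> c\<close> by (rule mult_left_mono)
  finally show ?thesis by (simp add: mult_ac)
qed

section \<open>Fixed points of weighted contractions on path spaces\<close>

lemma weighted_difference_bound:
  fixes f g :: "real \<Rightarrow> real^'n"
  assumes u: "\<And>i. 0 < u $ i" and "bounded (f ` S)" "bounded (g ` S)"
  shows "\<exists>c\<ge>0. \<forall>s\<in>S. \<forall>i. \<bar>f s $ i - g s $ i\<bar> \<le> c * u $ i"
proof -
  obtain A where A: "\<And>s. s \<in> S \<Longrightarrow> norm (f s) \<le> A" using assms(2) by (auto simp: bounded_iff)
  obtain B where B: "\<And>s. s \<in> S \<Longrightarrow> norm (g s) \<le> B" using assms(3) by (auto simp: bounded_iff)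
  define m where "m = Min (range (\<lambda>j. u $ j))"
  have m: "0 < m" "\<And>i. m \<le> u $ i" unfolding m_def using u by auto
  define c where "c = (\<bar>A\<bar> + \<bar>B\<bar>) / m"
  have "\<bar>f s $ i - g s $ i\<bar> \<le> c * u $ i" if "s \<in> S" for s i
  proof -
    have "\<bar>f s $ i - g s $ i\<bar> \<le> \<bar>A\<bar> + \<bar>B\<bar>"
      using A[OF that] B[OF that] component_le_norm_cart[of "f s" i] component_le_norm_cart[of "g s" i]
      by linarith
    also have "\<dots> = c * m" using m by (simp add: c_def)
    also have "\<dots> \<le> c * u $ i" using m by (intro mult_left_mono) (auto simp: c_def)
    finally show ?thesis .
  qed
  moreover have "c \<ge> 0" using m by (simp add: c_def)
  ultimately show ?thesis by blast
qed

text \<open>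
  Banach's theorem for paths on the half-line, where no single norm is finite: the hypothesis on
  \<open>F\<close> says that it is causal and contracts the weighted supremum over each \<open>[0,t]\<close> by the same
  factor, so the Picard iterates converge geometrically on every bounded interval, to one limit
  defined for all times. The class \<open>K\<close> is left open because continuous paths and monotone
  right-continuous paths are both used.
\<close>

lemma weighted_contraction_fixpoint_exists:
  fixes F :: "(real \<Rightarrow> real^'n) \<Rightarrow> real \<Rightarrow> real^'n" and u :: "real^'n"
  assumes u: "\<And>i. 0 < u $ i" and \<theta>: "0 \<le> \<theta>" "\<theta> < 1"
    and start: "K f\<^sub>0"
    and self: "\<And>f. K f \<Longrightarrow> K (F f)"
    and bdd: "\<And>f t. K f \<Longrightarrow> bounded (f ` {0..t})"
    and closed: "\<And>f g. (\<And>n. K (f n)) \<Longrightarrow> (\<And>t. uniform_limit {0..t} f g sequentially) \<Longrightarrow> K g"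
    and contr: "\<And>f g t c i. K f \<Longrightarrow> K g \<Longrightarrow> 0 \<le> t \<Longrightarrow> 0 \<le> c \<Longrightarrow>
       (\<And>s i. s \<in> {0..t} \<Longrightarrow> \<bar>f s $ i - g s $ i\<bar> \<le> c * u $ i) \<Longrightarrow>
       \<bar>F f t $ i - F g t $ i\<bar> \<le> \<theta> * c * u $ i"
  shows "\<exists>f. K f \<and> (\<forall>t\<ge>0. F f t = f t)"
proof -
  define f where "f n = (F ^^ n) f\<^sub>0" for n
  have f_Suc: "f (Suc n) = F (f n)" and f_0: "f 0 = f\<^sub>0" for n by (simp_all add: f_def)
  have Kf: "K (f n)" for n by (induction n) (auto simp: f_Suc f_0 start self)
  have step: "\<exists>c\<ge>0. \<forall>n. \<forall>s\<in>{0..t}. \<forall>i. \<bar>f (Suc n) s $ i - f n s $ i\<bar> \<le> \<theta> ^ n * c * u $ i" for t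
  proof -
    obtain c where c: "c \<ge> 0" "\<And>s i. s \<in> {0..t} \<Longrightarrow> \<bar>f 1 s $ i - f 0 s $ i\<bar> \<le> c * u $ i"
      using weighted_difference_bound[of u "f 1" "{0..t}" "f 0"] u bdd[OF Kf] by metis
    have "\<forall>s\<in>{0..t}. \<forall>i. \<bar>f (Suc n) s $ i - f n s $ i\<bar> \<le> \<theta> ^ n * c * u $ i" for n
    proof (induction n)
      case 0
      then show ?case using c by simp
    next
      case (Suc n)
      show ?case
      proof (intro ballI allI)
        fix s i assume s: "s \<in> {0..t}"
        have "\<bar>F (f (Suc n)) s $ i - F (f n) s $ i\<bar> \<le> \<theta> * (\<theta> ^ n * c) * u $ i"
          using Suc s c \<theta> by (intro contr Kf) auto
        then show "\<bar>f (Suc (Suc n)) s $ i - f (Suc n) s $ i\<bar> \<le> \<theta> ^ Suc n * c * u $ i"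
          by (simp add: f_Suc mult_ac)
      qed
    qed
    with c show ?thesis by blast
  qed
  define g where "g s = f 0 s + (\<Sum>k. f (Suc k) s - f k s)" for s
  have lim: "uniform_limit {0..t} f g sequentially" for t
  proof -
    obtain c where c: "c \<ge> 0" "\<And>n s i. s \<in> {0..t} \<Longrightarrow> \<bar>f (Suc n) s $ i - f n s $ i\<bar> \<le> \<theta> ^ n * c * u $ i"
      using step[of t] by blast
    have "uniform_limit {0..t} (\<lambda>n s. \<Sum>k<n. f (Suc k) s - f k s) (\<lambda>s. \<Sum>k. f (Suc k) s - f k s) sequentially"
    proof (rule Weierstrass_m_test)
      show "norm (f (Suc n) s - f n s) \<le> \<theta> ^ n * (c * (\<Sum>i\<in>UNIV. u $ i))" if "s \<in> {0..t}" for n s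
      proof -
        have "norm (f (Suc n) s - f n s) \<le> (\<Sum>i\<in>UNIV. \<bar>(f (Suc n) s - f n s) $ i\<bar>)"
          by (rule norm_le_l1_cart)
        also have "\<dots> \<le> (\<Sum>i\<in>UNIV. \<theta> ^ n * c * u $ i)"
          using c(2)[OF that] by (intro sum_mono) simp
        finally show ?thesis by (simp add: sum_distrib_left mult_ac)
      qed
      show "summable (\<lambda>n. \<theta> ^ n * (c * (\<Sum>i\<in>UNIV. u $ i)))"
        using \<theta> by (intro summable_mult2 summable_geometric) auto
    qed
    then have "uniform_limit {0..t} (\<lambda>n s. f 0 s + (\<Sum>k<n. f (Suc k) s - f k s)) g sequentially"
      unfolding g_def by (intro uniform_limit_intros)
    moreover have "f 0 s + (\<Sum>k<n. f (Suc k) s - f k s) = f n s" for n s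
      by (subst sum_lessThan_telescope) simp
    ultimately show ?thesis by simp
  qed
  have Kg: "K g" using Kf lim by (rule closed)
  have "F g t $ i = g t $ i" if t: "t \<ge> 0" for t i
  proof (rule LIMSEQ_unique)
    have "(\<lambda>n. f n t) \<longlonglongrightarrow> g t" by (rule tendsto_uniform_limitI[OF lim, of t]) (use t in auto)
    then show "(\<lambda>n. f (Suc n) t $ i) \<longlonglongrightarrow> g t $ i"
      by (intro tendsto_vec_nth) (rule LIMSEQ_Suc)
    show "(\<lambda>n. f (Suc n) t $ i) \<longlonglongrightarrow> F g t $ i"
    proof (rule tendstoI)
      fix e :: real assume "e > 0"
      \<comment> \<open>being within \<open>m\<close> in norm forces weighted distance at most \<open>c\<close>, and \<open>c * u $ i\<close> is \<open>e / 2\<close>\<close>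
      define c where "c = e / u $ i / 2"
      have "c > 0" using \<open>e > 0\<close> u by (simp add: c_def)
      define m where "m = Min (range (\<lambda>j. c * u $ j))"
      have "m > 0" unfolding m_def using u \<open>c > 0\<close> by simp
      have m_le: "m \<le> c * u $ j" for j unfolding m_def by (rule Min_le) auto
      have "\<forall>\<^sub>F n in sequentially. \<forall>s\<in>{0..t}. dist (f n s) (g s) < m"
        using uniform_limitD[OF lim \<open>m > 0\<close>] .
      then show "\<forall>\<^sub>F n in sequentially. dist (f (Suc n) t $ i) (F g t $ i) < e"
      proof eventually_elim
        case (elim n)
        have "\<bar>f n s $ j - g s $ j\<bar> \<le> c * u $ j" if "s \<in> {0..t}" for s j
          using elim that m_le[of j] component_le_norm_cart[of "f n s - g s" j]
          by (fastforce simp: dist_norm)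
        then have "\<bar>F (f n) t $ i - F g t $ i\<bar> \<le> \<theta> * c * u $ i"
          using t \<open>c > 0\<close> by (intro contr Kf Kg) auto
        also have "\<dots> = \<theta> * (e / 2)" using u[of i] by (simp add: c_def)
        also have "\<dots> < e" using \<theta> \<open>e > 0\<close> by (smt (verit) field_sum_of_halves mult_left_le_one_le)
        finally show ?case by (simp add: f_Suc dist_real_def)
      qed
    qed
  qed
  with Kg show ?thesis by (auto simp: vec_eq_iff)
qed

lemma weighted_contraction_fixpoint_unique:
  fixes F :: "(real \<Rightarrow> real^'n) \<Rightarrow> real \<Rightarrow> real^'n" and u :: "real^'n"
  assumes u: "\<And>i. 0 < u $ i" and \<theta>: "0 \<le> \<theta>" "\<theta> < 1"
    and bdd: "\<And>t. bounded (f ` {0..t})" "\<And>t. bounded (g ` {0..t})"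
    and contr: "\<And>t c i. 0 \<le> t \<Longrightarrow> 0 \<le> c \<Longrightarrow>
       (\<And>s i. s \<in> {0..t} \<Longrightarrow> \<bar>f s $ i - g s $ i\<bar> \<le> c * u $ i) \<Longrightarrow>
       \<bar>F f t $ i - F g t $ i\<bar> \<le> \<theta> * c * u $ i"
    and fixed: "\<And>t. 0 \<le> t \<Longrightarrow> F f t = f t" "\<And>t. 0 \<le> t \<Longrightarrow> F g t = g t" and "0 \<le> t"
  shows "f t = g t"
proof -
  obtain c where c: "c \<ge> 0" "\<And>s i. s \<in> {0..t} \<Longrightarrow> \<bar>f s $ i - g s $ i\<bar> \<le> c * u $ i"
    using weighted_difference_bound[of u f "{0..t}" g] u bdd by metis
  have bound: "\<forall>s\<in>{0..t}. \<forall>i. \<bar>f s $ i - g s $ i\<bar> \<le> \<theta> ^ n * c * u $ i" for n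
  proof (induction n)
    case 0
    then show ?case using c by simp
  next
    case (Suc n)
    have "\<bar>F f s $ i - F g s $ i\<bar> \<le> \<theta> * (\<theta> ^ n * c) * u $ i" if "s \<in> {0..t}" for s i
      using Suc that c \<theta> by (intro contr) auto
    then show ?case by (simp add: fixed mult_ac)
  qed
  have "f t $ i = g t $ i" for i
  proof -
    have "(\<lambda>n. \<theta> ^ n * c * u $ i) \<longlonglongrightarrow> 0 * c * u $ i"
      using \<theta> by (intro tendsto_intros LIMSEQ_power_zero) auto
    then have "\<bar>f t $ i - g t $ i\<bar> \<le> 0 * c * u $ i"
      using bound \<open>0 \<le> t\<close> by (intro LIMSEQ_le_const) auto
    then show ?thesis by simp
  qed
  then show ?thesis by (simp add: vec_eq_iff)
qed

section \<open>Vanishing Stieltjes integrals\<close>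

text \<open>
  This is the complementarity condition without measures. The intervals are
  open on the left because the Stieltjes measure of \<open>(a,b]\<close> is \<open>w b - w a\<close> for right-continuous
  \<open>w\<close>: a jump at a zero \<open>a\<close> of \<open>z\<close> is allowed, a move afterwards in the same excursion is not.
\<close>

definition flat_off_zeros :: "(real \<Rightarrow> real) \<Rightarrow> (real \<Rightarrow> real) \<Rightarrow> bool" where
  "flat_off_zeros z w \<longleftrightarrow>
     (\<forall>a b. 0 \<le> a \<longrightarrow> a \<le> b \<longrightarrow> (\<forall>s\<in>{a<..b}. z s \<noteq> 0) \<longrightarrow> w a = w b)"

lemma continuous_at_right_max_zero:
  fixes w :: "real \<Rightarrow> real"
  assumes "\<And>t. 0 \<le> t \<Longrightarrow> continuous (at_right t) w"
  shows "continuous (at_right t) (\<lambda>s. w (max 0 s))"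
proof (cases "0 \<le> t")
  case True
  have "\<forall>\<^sub>F s in at_right t. w s = w (max 0 s)"
    using True by (auto simp: eventually_at_right_field max_def intro!: exI[of _ "t + 1"])
  then show ?thesis
    using assms[OF True] True by (auto simp: continuous_within elim: Lim_transform_eventually)
next
  case False
  then have "\<forall>\<^sub>F s in at_right t. w (max 0 s) = w 0"
    by (auto simp: eventually_at_right_field max_def intro!: exI[of _ 0])
  then show ?thesis
    using False by (simp add: continuous_within tendsto_eventually)
qed

text \<open>
  The integral vanishes iff the Stieltjes measure does not charge the set where \<open>z\<close> is nonzero.
  Since \<open>z\<close> is continuous, this set is covered by countably many intervals \<open>(p,q]\<close> with
  rational ends on which \<open>z\<close> has no zero, together with time \<open>0\<close>; the latter is not charged
  because \<open>w\<close> is extended by a constant to negative times.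
\<close>

lemma stieltjes_component_eq_0_iff:
  fixes z w :: "real \<Rightarrow> real"
  assumes z: "continuous_on {0..} z" "\<And>t. 0 \<le> t \<Longrightarrow> 0 \<le> z t"
    and w: "mono_on {0..} w" "\<And>t. 0 \<le> t \<Longrightarrow> continuous (at_right t) w"
  shows "(\<integral>\<^sup>+ t\<in>{0..}. ennreal (z t) \<partial>interval_measure (\<lambda>s. w (max 0 s))) = 0 \<longleftrightarrow>
    flat_off_zeros z w"
proof -
  define M where "M = interval_measure (\<lambda>s. w (max 0 s))"
  have Ioc: "emeasure M {a<..b} = ennreal (w (max 0 b) - w (max 0 a))" if "a \<le> b" for a b
    unfolding M_def using that w
    by (intro emeasure_interval_measure_Ioc continuous_at_right_max_zero)
      (auto simp: mono_on_def max_def)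
  have z0: "ennreal (z t) = 0 \<longleftrightarrow> z t = 0" if "0 \<le> t" for t
    using z(2)[OF that] by (simp add: ennreal_eq_0_iff)
  have sets_M: "sets M = sets borel" "space M = UNIV" by (simp_all add: M_def)
  define U where "U = {t. 0 \<le> t \<and> z t \<noteq> 0}"
  have "(\<lambda>t. z t * indicator {0..} t) \<in> borel_measurable borel"
    using borel_measurable_continuous_on_indicator[OF _ z(1)] by (simp add: mult.commute)
  then have meas_z: "(\<lambda>t. ennreal (z t * indicator {0..} t)) \<in> borel_measurable borel"
    by simp
  have "(\<lambda>t. ennreal (z t) * indicator {0..} t) = (\<lambda>t. ennreal (z t * indicator {0..} t))"
    by (auto simp: indicator_def)
  with meas_z have meas: "(\<lambda>t. ennreal (z t) * indicator {0..} t) \<in> borel_measurable M"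
    by (simp add: measurable_cong_sets[OF sets_M(1) refl])
  have U: "U \<in> sets M"
  proof -
    have "U = {t \<in> space borel. ennreal (z t * indicator {0..} t) \<noteq> 0}"
      by (auto simp: U_def indicator_def z0)
    also have "\<dots> \<in> sets borel" using meas_z by measurable
    finally show ?thesis using sets_M by simp
  qed
  have "(\<integral>\<^sup>+ t\<in>{0..}. ennreal (z t) \<partial>M) = 0 \<longleftrightarrow> (AE t in M. ennreal (z t) * indicator {0..} t = 0)"
    by (rule nn_integral_0_iff_AE[OF meas])
  also have "\<dots> \<longleftrightarrow> (AE t in M. t \<notin> U)"
    by (intro AE_cong) (auto simp: U_def indicator_def z0)
  also have "\<dots> \<longleftrightarrow> U \<in> null_sets M" using AE_iff_null_sets[OF U] by simp
  also have "\<dots> \<longleftrightarrow> flat_off_zeros z w"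
  proof
    assume null: "U \<in> null_sets M"
    show "flat_off_zeros z w"
      unfolding flat_off_zeros_def
    proof (intro allI impI)
      fix a b assume ab: "0 \<le> a" "a \<le> b" "\<forall>s\<in>{a<..b}. z s \<noteq> 0"
      then have "{a<..b} \<subseteq> U" by (auto simp: U_def)
      then have "emeasure M {a<..b} = 0"
        using null_sets_subset[OF null] sets_M by (intro null_setsD1) auto
      then have "w b \<le> w a" using Ioc ab by (simp add: ennreal_eq_0_iff)
      then show "w a = w b" using w(1) ab by (auto simp: mono_on_def intro: antisym)
    qed
  next
    assume flat: "flat_off_zeros z w"
    define I where "I = {(p, q). p \<in> \<rat> \<and> q \<in> \<rat> \<and> 0 \<le> p \<and> p \<le> q \<and> (\<forall>s\<in>{p<..q}. z s \<noteq> 0)}"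
    have "I \<subseteq> \<rat> \<times> \<rat>" by (auto simp: I_def)
    then have "countable I" using countable_rat by (meson countable_SIGMA countable_subset)
    moreover have "{p<..q} \<in> null_sets M" if "(p, q) \<in> I" for p q
    proof -
      have "w p = w q" using flat that by (auto simp: I_def flat_off_zeros_def)
      then show ?thesis using that Ioc[of p q] sets_M by (auto simp: I_def null_sets_def)
    qed
    ultimately have "(\<Union>(p, q)\<in>I. {p<..q}) \<in> null_sets M"
      by (intro null_sets_UN') auto
    moreover have "{-1<..0} \<in> null_sets M" using Ioc[of "-1" 0] sets_M by (simp add: null_sets_def)
    ultimately have null: "(\<Union>(p, q)\<in>I. {p<..q}) \<union> {-1<..0} \<in> null_sets M" by (rule null_sets.Un)
    have "U \<subseteq> (\<Union>(p, q)\<in>I. {p<..q}) \<union> {-1<..0}"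
    proof
      fix t assume "t \<in> U"
      then have t: "0 \<le> t" "z t \<noteq> 0" by (auto simp: U_def)
      show "t \<in> (\<Union>(p, q)\<in>I. {p<..q}) \<union> {-1<..0}"
      proof (cases "t = 0")
        case False
        have "\<forall>\<^sub>F s in at t within {0..}. z s \<noteq> 0"
          using z(1) t by (intro tendsto_imp_eventually_ne[where c = "z t"]) (auto simp: continuous_on_def)
        then obtain d where d: "0 < d" "\<And>s. 0 \<le> s \<Longrightarrow> dist s t < d \<Longrightarrow> z s \<noteq> 0"
          using t unfolding eventually_at by (metis atLeast_iff)
        obtain p where p: "p \<in> \<rat>" "max 0 (t - d) < p" "p < t"
          using Rats_dense_in_real[of "max 0 (t - d)" t] False t d by auto
        obtain q where q: "q \<in> \<rat>" "t < q" "q < t + d"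
          using Rats_dense_in_real[of t "t + d"] d by auto
        have "z s \<noteq> 0" if "s \<in> {p<..q}" for s
          by (rule d(2)) (use p q that in \<open>auto simp: dist_real_def\<close>)
        then have "(p, q) \<in> I" using p q by (auto simp: I_def)
        then show ?thesis using p q by (intro UnI1 UN_I[of "(p, q)"]) auto
      qed auto
    qed
    then show "U \<in> null_sets M" using null U by (rule null_sets_subset[rotated 2])
  qed
  finally show ?thesis by (simp add: M_def)
qed

lemma stieltjes_integral_eq_0_iff:
  fixes z w :: "real \<Rightarrow> real^'n"
  assumes z: "continuous_on {0..} z" "\<And>t i. 0 \<le> t \<Longrightarrow> 0 \<le> z t $ i"
    and w: "\<And>i. mono_on {0..} (\<lambda>t. w t $ i)" "\<And>t. 0 \<le> t \<Longrightarrow> continuous (at_right t) w"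
  shows "stieltjes_integral z w = 0 \<longleftrightarrow> (\<forall>i. flat_off_zeros (\<lambda>t. z t $ i) (\<lambda>t. w t $ i))"
proof -
  have "(\<integral>\<^sup>+ t\<in>{0..}. ennreal (z t $ i) \<partial>interval_measure (\<lambda>s. w (max 0 s) $ i)) = 0 \<longleftrightarrow>
      flat_off_zeros (\<lambda>t. z t $ i) (\<lambda>t. w t $ i)" for i
    using z(2) w(2)
    by (intro stieltjes_component_eq_0_iff[where w = "\<lambda>t. w t $ i"] continuous_intros z(1) w(1))
      (auto simp: continuous_within intro: tendsto_vec_nth)
  then show ?thesis by (simp add: stieltjes_integral_def)
qed

lemma flat_off_zeros_cong:
  assumes "\<And>t. 0 \<le> t \<Longrightarrow> z t = z' t" "\<And>t. 0 \<le> t \<Longrightarrow> w t = w' t"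
  shows "flat_off_zeros z w \<longleftrightarrow> flat_off_zeros z' w'"
  using assms by (simp add: flat_off_zeros_def)

section \<open>The value at the last zero\<close>

lemma flat_off_zerosD:
  assumes "flat_off_zeros z w" "0 \<le> a" "a \<le> b" "\<And>s. s \<in> {a<..b} \<Longrightarrow> z s \<noteq> 0"
  shows "w a = w b"
  using assms unfolding flat_off_zeros_def by blast

text \<open>
  A path that is flat off the zeros of \<open>z\<close> is determined by its values at those zeros: it keeps
  the value taken at the last one, or the initial value \<open>0\<close> before the first.
\<close>

definition last_zero_value :: "(real \<Rightarrow> real) \<Rightarrow> (real \<Rightarrow> real) \<Rightarrow> real \<Rightarrow> real" where
  "last_zero_value z g t =
     (if \<exists>s\<in>{0..t}. z s = 0 then g (Sup {s \<in> {0..t}. z s = 0}) else 0)"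

lemma last_zero_value_cases:
  fixes z :: "real \<Rightarrow> real"
  assumes z: "continuous_on {0..} z"
  obtains
    (none) "\<And>s. s \<in> {0..t} \<Longrightarrow> z s \<noteq> 0" "\<And>g. last_zero_value z g t = 0"
  | (last) \<sigma> where "\<sigma> \<in> {0..t}" "z \<sigma> = 0" "\<And>s. s \<in> {\<sigma><..t} \<Longrightarrow> z s \<noteq> 0"
      "\<And>g. last_zero_value z g t = g \<sigma>"
proof (cases "\<exists>s\<in>{0..t}. z s = 0")
  case True
  let ?Z = "{s \<in> {0..t}. z s = 0}"
  have "continuous_on {0..t} z" using z by (rule continuous_on_subset) auto
  then have "closed ?Z" by (rule continuous_closed_preimage_constant) simp
  moreover have bdd: "bdd_above ?Z" by (auto simp: bdd_above_def)
  ultimately have Sup: "Sup ?Z \<in> ?Z" using True by (intro closed_contains_Sup) auto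
  show ?thesis
  proof (rule last)
    show "Sup ?Z \<in> {0..t}" "z (Sup ?Z) = 0" using Sup by auto
    show "last_zero_value z g t = g (Sup ?Z)" for g using True by (simp add: last_zero_value_def)
    show "z s \<noteq> 0" if s: "s \<in> {Sup ?Z<..t}" for s
    proof
      assume "z s = 0"
      then have "s \<in> ?Z" using s Sup by auto
      then have "s \<le> Sup ?Z" using bdd by (rule cSup_upper)
      then show False using s by simp
    qed
  qed
next
  case False
  show ?thesis by (rule none) (use False in \<open>auto simp: last_zero_value_def\<close>)
qed

lemma last_zero_value_unique:
  assumes z: "continuous_on {0..} z" and flat: "flat_off_zeros z w" and "w 0 = 0"
    and g: "\<And>s. 0 \<le> s \<Longrightarrow> z s = 0 \<Longrightarrow> w s = g s" and "0 \<le> t"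
  shows "w t = last_zero_value z g t"
using z
  proof (cases rule: last_zero_value_cases[where t = t])
  case none
  have "w 0 = w t" by (rule flat_off_zerosD[OF flat]) (use none \<open>0 \<le> t\<close> in auto)
  then show ?thesis using none(2) \<open>w 0 = 0\<close> by simp
next
  case (last \<sigma>)
  have "w \<sigma> = w t" by (rule flat_off_zerosD[OF flat]) (use last in auto)
  then show ?thesis using last g[of \<sigma>] by simp
qed

lemma flat_off_zeros_last_zero_value: "flat_off_zeros z (last_zero_value z g)"
  unfolding flat_off_zeros_def
proof (intro allI impI)
  fix a b :: real assume "0 \<le> a" "a \<le> b" "\<forall>s\<in>{a<..b}. z s \<noteq> 0"
  then have "s \<in> {0..b} \<and> z s = 0 \<longleftrightarrow> s \<in> {0..a} \<and> z s = 0" for s by force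
  then show "last_zero_value z g a = last_zero_value z g b"
    unfolding last_zero_value_def Bex_def by presburger
qed

lemma last_zero_value_at_zero:
  assumes "0 \<le> t" "z t = 0" shows "last_zero_value z g t = g t"
proof -
  have "Sup {s \<in> {0..t}. z s = 0} = t" using assms by (intro cSup_eq_maximum) auto
  then show ?thesis using assms by (auto simp: last_zero_value_def)
qed

lemma last_zero_value_mono:
  assumes z: "continuous_on {0..} z" and g: "mono_on {0..} g" "\<And>t. 0 \<le> t \<Longrightarrow> 0 \<le> g t"
  shows "mono_on {0..} (last_zero_value z g)"
proof (rule mono_onI)
  fix s t :: real assume st: "s \<in> {0..}" "t \<in> {0..}" "s \<le> t"
  show "last_zero_value z g s \<le> last_zero_value z g t"
  using z
  proof (cases rule: last_zero_value_cases[where t = t])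
    case none
    have "last_zero_value z g s = 0"
      by (cases rule: last_zero_value_cases[OF z, of s]) (use none(1) st in auto)
    then show ?thesis using none(2) by simp
  next
    case \<tau>: (last \<tau>)
    show ?thesis
    using z
  proof (cases rule: last_zero_value_cases[where t = s])
      case none
      then show ?thesis using \<tau> g(2)[of \<tau>] by simp
    next
      case (last \<sigma>)
      then have "\<sigma> \<le> \<tau>" using \<tau>(3)[of \<sigma>] st by force
      then show ?thesis using last \<tau> mono_onD[OF g(1), of \<sigma> \<tau>] by simp
    qed
  qed
qed

lemma last_zero_value_le:
  assumes z: "continuous_on {0..} z" and g: "mono_on {0..} g" "\<And>t. 0 \<le> t \<Longrightarrow> 0 \<le> g t" and "0 \<le> t"
  shows "last_zero_value z g t \<le> g t"
using z
  proof (cases rule: last_zero_value_cases[where t = t])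
  case none
  then show ?thesis using g(2) \<open>0 \<le> t\<close> by simp
next
  case (last \<sigma>)
  then show ?thesis using mono_onD[OF g(1), of \<sigma> t] \<open>0 \<le> t\<close> by simp
qed

text \<open>
  The time of the last zero before \<open>s\<close> jumps, but as \<open>s\<close> decreases to a zero \<open>t\<close> it stays in
  \<open>[t,s]\<close>, so right-continuity of \<open>g\<close> suffices there; off the zeros the path is locally constant.
\<close>

lemma last_zero_value_right_continuous:
  assumes z: "continuous_on {0..} z" and g: "\<And>t. 0 \<le> t \<Longrightarrow> continuous (at_right t) g" and t: "0 \<le> t"
  shows "continuous (at_right t) (last_zero_value z g)"
  unfolding continuous_within_eps_delta
proof (intro allI impI)
  fix e :: real assume "e > 0"
  show "\<exists>d>0. \<forall>s\<in>{t<..}. dist s t < d \<longrightarrow> dist (last_zero_value z g s) (last_zero_value z g t) < e"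
  proof (cases "z t = 0")
    case True
    obtain d where d: "d > 0" "\<And>s. s \<in> {t<..} \<Longrightarrow> dist s t < d \<Longrightarrow> dist (g s) (g t) < e"
      using g[OF t] \<open>e > 0\<close> unfolding continuous_within_eps_delta by blast
    have "dist (last_zero_value z g s) (last_zero_value z g t) < e" if s: "s \<in> {t<..}" "dist s t < d" for s
    using z
  proof (cases rule: last_zero_value_cases[where t = s])
      case none
      then show ?thesis using s t True by force
    next
      case (last \<sigma>)
      then have "t \<le> \<sigma>" using s t True last(3)[of t] by force
      then have "dist (g \<sigma>) (g t) < e"
        using last(1) d(2)[of \<sigma>] s \<open>e > 0\<close>
        by (cases "\<sigma> = t") (auto simp: dist_real_def)
      then show ?thesis using last t True by (simp add: last_zero_value_at_zero)
    qed
    then show ?thesis using d(1) by blast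
  next
    case False
    have "\<forall>\<^sub>F s in at t within {0..}. z s \<noteq> 0"
      using z t False by (intro tendsto_imp_eventually_ne[where c = "z t"]) (auto simp: continuous_on_def)
    then obtain d where d: "0 < d" "\<And>s. 0 \<le> s \<Longrightarrow> s \<noteq> t \<Longrightarrow> dist s t < d \<Longrightarrow> z s \<noteq> 0"
      unfolding eventually_at by (metis atLeast_iff)
    have "last_zero_value z g t = last_zero_value z g s" if s: "s \<in> {t<..}" "dist s t < d" for s
    proof (rule flat_off_zerosD[OF flat_off_zeros_last_zero_value])
      show "z r \<noteq> 0" if "r \<in> {t<..s}" for r
        by (rule d(2)) (use that s t in \<open>auto simp: dist_real_def\<close>)
    qed (use s t in auto)
    then show ?thesis using d(1) \<open>e > 0\<close> by (metis dist_self)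
  qed
qed

lemma last_zero_value_nonexpansive:
  assumes z: "continuous_on {0..} z" and "\<And>s. s \<in> {0..t} \<Longrightarrow> \<bar>g s - h s\<bar> \<le> c" and "0 \<le> c"
  shows "\<bar>last_zero_value z g t - last_zero_value z h t\<bar> \<le> c"
  by (cases rule: last_zero_value_cases[OF z, of t]) (use assms in auto)

section \<open>The one-dimensional Skorohod map\<close>

definition running_max :: "(real \<Rightarrow> real) \<Rightarrow> real \<Rightarrow> real" where
  "running_max f t = (SUP s\<in>{0..t}. max 0 (f s))"

lemma running_max_attained:
  assumes "continuous_on {0..} f" "0 \<le> t"
  obtains s where "s \<in> {0..t}" "running_max f t = max 0 (f s)"
proof -
  have "continuous_on {0..t} (\<lambda>s. max 0 (f s))"
    by (intro continuous_intros continuous_on_subset[OF assms(1)]) auto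
  then obtain s where s: "s \<in> {0..t}" "\<forall>r\<in>{0..t}. max 0 (f r) \<le> max 0 (f s)"
    using continuous_attains_sup[of "{0..t}" "\<lambda>s. max 0 (f s)"] assms by auto
  then have "running_max f t = max 0 (f s)"
    unfolding running_max_def by (intro cSup_eq_maximum) auto
  with s(1) show ?thesis by (rule that)
qed

lemma running_max_upper:
  assumes "continuous_on {0..} f" "s \<in> {0..t}"
  shows "0 \<le> running_max f t" "f s \<le> running_max f t"
proof -
  have "continuous_on {0..t} (\<lambda>s. max 0 (f s))"
    by (intro continuous_intros continuous_on_subset[OF assms(1)]) auto
  then have "bdd_above ((\<lambda>s. max 0 (f s)) ` {0..t})"
    by (intro bounded_imp_bdd_above compact_imp_bounded compact_continuous_image) auto
  then have "max 0 (f s) \<le> running_max f t"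
    unfolding running_max_def using assms(2) by (intro cSUP_upper)
  then show "0 \<le> running_max f t" "f s \<le> running_max f t" by auto
qed

lemma running_max_mono:
  assumes f: "continuous_on {0..} f"
  shows "mono_on {0..} (running_max f)"
proof (rule mono_onI)
  fix s t :: real assume st: "s \<in> {0..}" "t \<in> {0..}" "s \<le> t"
  then obtain r where "r \<in> {0..s}" "running_max f s = max 0 (f r)"
    using running_max_attained[OF f, of s] by auto
  then show "running_max f s \<le> running_max f t" using running_max_upper[OF f, of r t] st by auto
qed

lemma running_max_nonexpansive:
  assumes f: "continuous_on {0..} f" and g: "continuous_on {0..} g"
    and c: "\<And>s. s \<in> {0..t} \<Longrightarrow> \<bar>f s - g s\<bar> \<le> c" and t: "0 \<le> t"
  shows "\<bar>running_max f t - running_max g t\<bar> \<le> c"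
proof -
  obtain r where r: "r \<in> {0..t}" "running_max f t = max 0 (f r)" using running_max_attained[OF f t] .
  obtain s where s: "s \<in> {0..t}" "running_max g t = max 0 (g s)" using running_max_attained[OF g t] .
  show ?thesis
    using r s c[OF r(1)] c[OF s(1)] running_max_upper[OF f s(1)] running_max_upper[OF g r(1)] by linarith
qed

lemma running_max_continuous:
  assumes f: "continuous_on {0..} f"
  shows "continuous_on {0..} (running_max f)"
  unfolding continuous_on_iff
proof (intro ballI allI impI)
  fix t e :: real assume t: "t \<in> {0..}" and "e > 0"
  obtain d where d: "d > 0" "\<And>s. s \<in> {0..} \<Longrightarrow> dist s t < d \<Longrightarrow> dist (f s) (f t) < e / 4"
    using f t \<open>e > 0\<close> unfolding continuous_on_iff by (metis zero_less_divide_iff zero_less_numeral)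
  have osc: "running_max f q \<le> running_max f p + e / 4 + e / 4"
    if pq: "0 \<le> p" "p \<le> q" "dist p t < d" "dist q t < d" for p q
  proof -
    obtain r where r: "r \<in> {0..q}" "running_max f q = max 0 (f r)"
      using running_max_attained[OF f, of q] pq by auto
    show ?thesis
    proof (cases "r \<le> p")
      case True
      then show ?thesis using r running_max_upper[OF f, of r p] \<open>e > 0\<close> by auto
    next
      case False
      then have "dist r t < d" using r pq by (auto simp: dist_real_def)
      then have "dist (f r) (f t) < e / 4" "dist (f p) (f t) < e / 4"
        using r pq d(2)[of r] d(2)[of p] by auto
      then have "f r < f p + e / 4 + e / 4" unfolding dist_real_def by linarith
      then show ?thesis using r running_max_upper[OF f, of p p] pq \<open>e > 0\<close> by auto
    qed
  qed
  show "\<exists>d>0. \<forall>s\<in>{0..}. dist s t < d \<longrightarrow> dist (running_max f s) (running_max f t) < e"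
  proof (intro exI[of _ d] conjI ballI impI)
    fix s assume "s \<in> {0..}" "dist s t < d"
    then show "dist (running_max f s) (running_max f t) < e"
      using osc[of s t] osc[of t s] running_max_mono[OF f] t d(1) \<open>e > 0\<close>
      by (cases s t rule: linorder_cases) (auto simp: mono_on_def dist_real_def)
  qed (rule d(1))
qed

text \<open>
  Below: \<open>y\<close> is nondecreasing and dominates \<open>- \<xi>\<close>. Above: at the last zero \<open>\<sigma>\<close> of
  \<open>\<xi> + y\<close> the path \<open>y\<close> equals \<open>- \<xi> \<sigma>\<close>, and since then it has not moved.
\<close>

lemma running_max_unique:
  assumes \<xi>: "continuous_on {0..} \<xi>" and y: "continuous_on {0..} y" "mono_on {0..} y" "y 0 = 0"
    and nonneg: "\<And>t. 0 \<le> t \<Longrightarrow> 0 \<le> \<xi> t + y t"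
    and flat: "flat_off_zeros (\<lambda>t. \<xi> t + y t) y" and t: "0 \<le> t"
  shows "y t = running_max (\<lambda>s. - \<xi> s) t"
proof (rule antisym)
  have neg: "continuous_on {0..} (\<lambda>s. - \<xi> s)" using \<xi> by (intro continuous_intros)
  obtain s where s: "s \<in> {0..t}" "running_max (\<lambda>s. - \<xi> s) t = max 0 (- \<xi> s)"
    using running_max_attained[OF neg t] .
  have "y 0 \<le> y t" "y s \<le> y t" using y(2) s(1) t by (auto simp: mono_on_def)
  then show "running_max (\<lambda>s. - \<xi> s) t \<le> y t" using s nonneg[of s] y(3) by auto
  have z: "continuous_on {0..} (\<lambda>t. \<xi> t + y t)" using \<xi> y(1) by (intro continuous_intros)
  have "y t = last_zero_value (\<lambda>t. \<xi> t + y t) (\<lambda>s. - \<xi> s) t"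
    using z flat y(3) t by (intro last_zero_value_unique) auto
  also have "\<dots> \<le> running_max (\<lambda>s. - \<xi> s) t"
    by (cases rule: last_zero_value_cases[OF z, of t])
      (use running_max_upper[OF neg, of _ t] t in auto)
  finally show "y t \<le> running_max (\<lambda>s. - \<xi> s) t" .
qed

text \<open>
  If the maximum grows on \<open>(a,b]\<close>, then its value at \<open>b\<close> is attained at some \<open>s > a\<close>, and at this
  \<open>s\<close> the reflected path \<open>\<xi> + y\<close> vanishes.
\<close>

lemma flat_off_zeros_running_max:
  assumes \<xi>: "continuous_on {0..} \<xi>"
  shows "flat_off_zeros (\<lambda>t. \<xi> t + running_max (\<lambda>s. - \<xi> s) t) (running_max (\<lambda>s. - \<xi> s))"
  unfolding flat_off_zeros_def
proof (intro allI impI)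
  let ?y = "running_max (\<lambda>s. - \<xi> s)"
  have neg: "continuous_on {0..} (\<lambda>s. - \<xi> s)" using \<xi> by (intro continuous_intros)
  fix a b :: real assume ab: "0 \<le> a" "a \<le> b" and off: "\<forall>s\<in>{a<..b}. \<xi> s + ?y s \<noteq> 0"
  obtain s where s: "s \<in> {0..b}" "?y b = max 0 (- \<xi> s)"
    using running_max_attained[OF neg, of b] ab by auto
  have mono: "?y p \<le> ?y q" if "0 \<le> p" "p \<le> q" for p q
    using running_max_mono[OF neg] that by (auto simp: mono_on_def)
  have "?y b \<le> ?y a"
  proof (rule ccontr)
    assume "\<not> ?y b \<le> ?y a"
    then have "?y b = - \<xi> s" "?y a < - \<xi> s"
      using s running_max_upper[OF neg, of a a] ab by auto
    moreover have "a < s"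
      using running_max_upper(2)[OF neg, of s a] s calculation by force
    moreover have "?y s = ?y b"
      using running_max_upper[OF neg, of s s] mono[of s b] s calculation by auto
    ultimately show False using off s by force
  qed
  then show "?y a = ?y b" using mono[OF ab] by simp
qed

section \<open>The multidimensional Skorohod problem\<close>

definition skorohod_problem ::
  "real^'n^'n \<Rightarrow> (real \<Rightarrow> real^'n) \<Rightarrow> (real \<Rightarrow> real^'n) \<Rightarrow> bool" where
  "skorohod_problem P x y \<longleftrightarrow>
     continuous_on {0..} y \<and> y 0 = 0 \<and> (\<forall>i. mono_on {0..} (\<lambda>t. y t $ i)) \<and>
     (\<forall>i. \<forall>t\<ge>0. 0 \<le> x t $ i - (P *v y t) $ i + y t $ i) \<and>
     (\<forall>i. flat_off_zeros (\<lambda>t. x t $ i - (P *v y t) $ i + y t $ i) (\<lambda>t. y t $ i))"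

lemma skorohod_problem_cong:
  assumes y: "skorohod_problem P x y" and eq: "\<And>t. 0 \<le> t \<Longrightarrow> y' t = y t"
  shows "skorohod_problem P x y'"
proof -
  have "continuous_on {0..} y'"
    using y continuous_on_cong[of "{0..}" "{0..}" y' y] eq by (simp add: skorohod_problem_def)
  then show ?thesis
    using y eq by (simp add: skorohod_problem_def mono_on_def flat_off_zeros_def)
qed

text \<open>
  With \<open>P y\<close> regarded as given, the coordinates decouple and each is a one-dimensional Skorohod
  problem for the path \<open>x\<^sub>i - (P y)\<^sub>i\<close>.
\<close>

definition reflection_map ::
  "real^'n^'n \<Rightarrow> (real \<Rightarrow> real^'n) \<Rightarrow> (real \<Rightarrow> real^'n) \<Rightarrow> real \<Rightarrow> real^'n" where
  "reflection_map P x y t = (\<chi> i. running_max (\<lambda>s. - (x s $ i - (P *v y s) $ i)) t)"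

lemma continuous_on_free_path:
  fixes x y :: "real \<Rightarrow> real^'n"
  assumes "continuous_on S x" "continuous_on S y"
  shows "continuous_on S (\<lambda>t. x t $ i - (P *v y t) $ i)"
  unfolding matrix_vector_mult_def vec_lambda_beta by (intro continuous_intros assms)

lemma skorohod_problem_iff_fixpoint:
  assumes x: "continuous_on {0..} x" and y: "continuous_on {0..} y" "y 0 = 0"
  shows "skorohod_problem P x y \<longleftrightarrow> (\<forall>t\<ge>0. reflection_map P x y t = y t)"
proof
  assume sp: "skorohod_problem P x y"
  show "\<forall>t\<ge>0. reflection_map P x y t = y t"
  proof (intro allI impI)
    fix t :: real assume t: "0 \<le> t"
    have "y t $ i = running_max (\<lambda>s. - (x s $ i - (P *v y s) $ i)) t" for i
      using sp y(2) t unfolding skorohod_problem_def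
      by (intro running_max_unique continuous_on_free_path[OF x y(1)] continuous_on_component[OF y(1)]) auto
    then show "reflection_map P x y t = y t" by (simp add: reflection_map_def vec_eq_iff)
  qed
next
  assume fixed: "\<forall>t\<ge>0. reflection_map P x y t = y t"
  have eq: "y t $ i = running_max (\<lambda>s. - (x s $ i - (P *v y s) $ i)) t" if "0 \<le> t" for t i
    using arg_cong[OF fixed[rule_format, OF that], of "\<lambda>v. v $ i"] by (simp add: reflection_map_def)
  note path = continuous_on_free_path[OF x y(1)]
  have neg: "continuous_on {0..} (\<lambda>s. - (x s $ i - (P *v y s) $ i))" for i
    by (intro continuous_intros path)
  have "mono_on {0..} (\<lambda>t. y t $ i)" for i
    using running_max_mono[OF neg, of i] eq by (simp add: mono_on_def)
  moreover have "0 \<le> x t $ i - (P *v y t) $ i + y t $ i" if "0 \<le> t" for t i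
    using running_max_upper(2)[OF neg, of t t i] that eq[OF that, of i] by simp
  moreover have "flat_off_zeros (\<lambda>t. x t $ i - (P *v y t) $ i + y t $ i) (\<lambda>t. y t $ i)" for i
    by (rule flat_off_zeros_cong[THEN iffD1, OF _ _ flat_off_zeros_running_max[OF path, of i]])
      (simp_all add: eq)
  ultimately show "skorohod_problem P x y" using y by (simp add: skorohod_problem_def)
qed

lemma reflection_map_contraction:
  assumes P: "0 \<le> P" "(P *v u) $ i \<le> \<theta> * u $ i" and x: "continuous_on {0..} x"
    and f: "continuous_on {0..} f" and g: "continuous_on {0..} g" and t: "0 \<le> t" and c: "0 \<le> c"
    and fg: "\<And>s i. s \<in> {0..t} \<Longrightarrow> \<bar>f s $ i - g s $ i\<bar> \<le> c * u $ i"
  shows "\<bar>reflection_map P x f t $ i - reflection_map P x g t $ i\<bar> \<le> \<theta> * c * u $ i"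
  unfolding reflection_map_def vec_lambda_beta
proof (rule running_max_nonexpansive)
  show "\<bar>- (x s $ i - (P *v f s) $ i) - - (x s $ i - (P *v g s) $ i)\<bar> \<le> \<theta> * c * u $ i"
    if "s \<in> {0..t}" for s
    using weighted_contraction[OF P c fg[OF that]] by simp
qed (intro continuous_intros continuous_on_free_path x f g t)+

lemma skorohod_problem_exists:
  fixes x :: "real \<Rightarrow> real^'n"
  assumes "0 \<le> P" "matrix_spectral_radius P < 1" and x: "continuous_on {0..} x" "0 \<le> x 0"
  shows "\<exists>y. skorohod_problem P x y"
proof -
  obtain u \<theta> where u: "\<And>i. 0 < u $ i" and \<theta>: "0 \<le> \<theta>" "\<theta> < 1" "\<And>i. (P *v u) $ i \<le> \<theta> * u $ i"
    using exists_contracted_weight[OF assms(1,2)] by blast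
  define K where "K y \<longleftrightarrow> continuous_on {0..} y \<and> y 0 = 0" for y :: "real \<Rightarrow> real^'n"
  have "\<exists>y. K y \<and> (\<forall>t\<ge>0. reflection_map P x y t = y t)"
  proof (rule weighted_contraction_fixpoint_exists[OF u \<theta>(1,2)])
    show "K (\<lambda>_. 0)" by (simp add: K_def)
    show "K (reflection_map P x f)" if "K f" for f
    proof -
      have f: "continuous_on {0..} f" "f 0 = 0" using that by (auto simp: K_def)
      have "running_max (\<lambda>s. - (x s $ i - (P *v f s) $ i)) 0 = 0" for i
        using x(2) f(2) by (simp add: running_max_def less_eq_vec_def)
      moreover have "continuous_on {0..} (reflection_map P x f)"
        unfolding reflection_map_def
        by (intro continuous_on_vec_lambda running_max_continuous continuous_intros
            continuous_on_free_path x f)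
      ultimately show ?thesis by (simp add: K_def reflection_map_def vec_eq_iff)
    qed
    show "bounded (f ` {0..t})" if "K f" for f t
      using that unfolding K_def
      by (intro compact_imp_bounded compact_continuous_image) (auto elim: continuous_on_subset)
    show "K g" if f: "\<And>n. K (f n)" and lim: "\<And>t. uniform_limit {0..t} f g sequentially" for f g
    proof -
      have cont: "continuous_on {0..t} g" for t
        by (rule uniform_limit_theorem[OF _ lim])
          (use f in \<open>auto simp: K_def intro!: always_eventually continuous_on_subset[of "{0..}" _ "{0..t}"]\<close>)
      have "continuous (at s within {0..}) g" if "0 \<le> s" for s
      proof -
        have "at s within {0..} = at s within {0..s + 1}"
          by (rule at_within_nhd[of s "{..<s + 1}"]) auto
        then show ?thesis
          using cont[of "s + 1"] that by (simp add: continuous_on_eq_continuous_within)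
      qed
      moreover have "(\<lambda>n. f n 0) \<longlonglongrightarrow> g 0" by (rule tendsto_uniform_limitI[OF lim[of 0]]) simp
      then have "g 0 = 0" using f by (simp add: K_def LIMSEQ_const_iff)
      ultimately show ?thesis by (simp add: K_def continuous_on_eq_continuous_within)
    qed
    show "\<bar>reflection_map P x f t $ i - reflection_map P x g t $ i\<bar> \<le> \<theta> * c * u $ i"
      if "K f" "K g" "0 \<le> t" "0 \<le> c"
        and "\<And>s i. s \<in> {0..t} \<Longrightarrow> \<bar>f s $ i - g s $ i\<bar> \<le> c * u $ i" for f g t c i
      using that by (intro reflection_map_contraction assms \<theta>) (auto simp: K_def)
  qed
  then show ?thesis using skorohod_problem_iff_fixpoint[OF x(1)] by (auto simp: K_def)
qed

lemma skorohod_problem_unique: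
  fixes x :: "real \<Rightarrow> real^'n"
  assumes "0 \<le> P" "matrix_spectral_radius P < 1" and x: "continuous_on {0..} x"
    and sp: "skorohod_problem P x y" "skorohod_problem P x y'" and t: "0 \<le> t"
  shows "y t = y' t"
proof -
  obtain u \<theta> where u: "\<And>i. 0 < u $ i" and \<theta>: "0 \<le> \<theta>" "\<theta> < 1" "\<And>i. (P *v u) $ i \<le> \<theta> * u $ i"
    using exists_contracted_weight[OF assms(1,2)] by blast
  have cont: "continuous_on {0..} y" "continuous_on {0..} y'" and init: "y 0 = 0" "y' 0 = 0"
    using sp by (auto simp: skorohod_problem_def)
  have bdd: "bounded (f ` {0..t})" if "continuous_on {0..} f" for f :: "real \<Rightarrow> real^'n" and t
    by (intro compact_imp_bounded compact_continuous_image continuous_on_subset[OF that]) auto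
  show ?thesis
  proof (rule weighted_contraction_fixpoint_unique[OF u \<theta>(1,2) bdd bdd])
    show "reflection_map P x y s = y s" "reflection_map P x y' s = y' s" if "0 \<le> s" for s
      using sp skorohod_problem_iff_fixpoint[OF x cont(1) init(1)]
        skorohod_problem_iff_fixpoint[OF x cont(2) init(2)] that by blast+
  qed (use t cont in \<open>auto intro!: reflection_map_contraction[OF assms(1) \<theta>(3) x]\<close>)
qed

section \<open>The regulator of the augmented component\<close>

definition regulator_path :: "(real \<Rightarrow> real^'n) \<Rightarrow> bool" where
  "regulator_path b \<longleftrightarrow>
     b 0 = 0 \<and> (\<forall>i. mono_on {0..} (\<lambda>t. b t $ i)) \<and> (\<forall>t\<ge>0. continuous (at_right t) b)"

lemma regulator_pathD:
  assumes "regulator_path b"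
  shows "mono_on {0..} (\<lambda>t. b t $ i)" "0 \<le> t \<Longrightarrow> continuous (at_right t) b"
  using assms by (simp_all add: regulator_path_def)

lemma regulator_path_bounded:
  fixes b :: "real \<Rightarrow> real^'n"
  assumes "regulator_path b"
  shows "bounded (b ` {0..t})"
proof -
  have "norm (b s) \<le> (\<Sum>i\<in>UNIV. b t $ i)" if "s \<in> {0..t}" for s
  proof -
    have "0 \<le> b s $ i" "b s $ i \<le> b t $ i" for i
      using assms that unfolding regulator_path_def mono_on_def
      by (metis atLeastAtMost_iff atLeast_iff order_refl order_trans zero_index)+
    then show ?thesis by (intro order_trans[OF norm_le_l1_cart] sum_mono) simp
  qed
  then show ?thesis unfolding bounded_iff by blast
qed

lemma regulator_path_uniform_limit:
  fixes f :: "nat \<Rightarrow> real \<Rightarrow> real^'n"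
  assumes f: "\<And>n. regulator_path (f n)" and lim: "\<And>t. uniform_limit {0..t} f g sequentially"
  shows "regulator_path g"
proof -
  have ptw: "(\<lambda>n. f n t) \<longlonglongrightarrow> g t" if "0 \<le> t" for t
    by (rule tendsto_uniform_limitI[OF lim[of t]]) (use that in simp)
  have "g 0 = 0" using ptw[of 0] f by (simp add: regulator_path_def LIMSEQ_const_iff)
  moreover have "mono_on {0..} (\<lambda>t. g t $ i)" for i
  proof (rule mono_onI)
    fix s t :: real assume st: "s \<in> {0..}" "t \<in> {0..}" "s \<le> t"
    then show "g s $ i \<le> g t $ i"
      using f by (intro LIMSEQ_le[OF tendsto_vec_nth[OF ptw[of s]] tendsto_vec_nth[OF ptw[of t]]])
        (auto simp: regulator_path_def mono_on_def)
  qed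
  moreover have "continuous (at_right t) g" if t: "0 \<le> t" for t
  proof -
    have "uniform_limit {t..t + 1} f g sequentially"
      by (rule uniform_limit_on_subset[OF lim[of "t + 1"]]) (use t in auto)
    moreover have "\<forall>\<^sub>F n in sequentially. (f n \<longlongrightarrow> f n t) (at t within {t..t + 1})"
      using f t by (auto simp: regulator_path_def continuous_within at_within_Icc_at_right)
    ultimately have "(g \<longlongrightarrow> g t) (at t within {t..t + 1})"
      using ptw[OF t] by (intro swap_uniform_limit) auto
    then show ?thesis by (simp add: continuous_within at_within_Icc_at_right)
  qed
  ultimately show ?thesis by (simp add: regulator_path_def)
qed

text \<open>
  The conditions on one column of \<open>b\<close> once \<open>z\<close> is known, with \<open>c\<close> the same column of \<open>\<chi>\<close>: the
  inequality says that the column of \<open>a\<close> is nonnegative, and the last clause is the vanishing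
  of its \<open>i\<close>th entry at the zeros of \<open>z\<^sub>i\<close>.
\<close>

definition excursion_problem ::
  "real^'n^'n \<Rightarrow> (real \<Rightarrow> real^'n) \<Rightarrow> (real \<Rightarrow> real^'n) \<Rightarrow> (real \<Rightarrow> real^'n) \<Rightarrow> bool" where
  "excursion_problem P z c b \<longleftrightarrow>
     regulator_path b \<and>
     (\<forall>i. flat_off_zeros (\<lambda>t. z t $ i) (\<lambda>t. b t $ i)) \<and>
     (\<forall>i. \<forall>t\<ge>0. b t $ i \<le> c t $ i + (P *v b t) $ i) \<and>
     (\<forall>i. \<forall>t\<ge>0. z t $ i = 0 \<longrightarrow> b t $ i = c t $ i + (P *v b t) $ i)"

lemma excursion_problem_cong:
  assumes b: "excursion_problem P z c b" and eq: "\<And>t. 0 \<le> t \<Longrightarrow> b' t = b t"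
  shows "excursion_problem P z c b'"
proof -
  have "continuous (at_right t) b'" if t: "0 \<le> t" for t
  proof -
    have "(b \<longlongrightarrow> b' t) (at_right t)"
      using b eq t by (simp add: excursion_problem_def regulator_path_def continuous_within)
    moreover have "\<forall>\<^sub>F s in at_right t. b s = b' s"
      using t eq by (auto simp: eventually_at_right_field intro!: exI[of _ "t + 1"])
    ultimately show ?thesis unfolding continuous_within by (rule Lim_transform_eventually)
  qed
  then show ?thesis
    using b eq by (simp add: excursion_problem_def regulator_path_def mono_on_def flat_off_zeros_def)
qed

definition excursion_map ::
  "real^'n^'n \<Rightarrow> (real \<Rightarrow> real^'n) \<Rightarrow> (real \<Rightarrow> real^'n) \<Rightarrow> (real \<Rightarrow> real^'n) \<Rightarrow> real \<Rightarrow> real^'n" where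
  "excursion_map P z c b t =
     (\<chi> i. last_zero_value (\<lambda>s. z s $ i) (\<lambda>s. c s $ i + (P *v b s) $ i) t)"

text \<open>
  The condition \<open>init\<close> is what lets \<open>b\<close> start at \<open>0\<close> in coordinates where \<open>z\<close> starts at \<open>0\<close>.
\<close>

locale excursion_data =
  fixes P :: "real^'n^'n" and z c :: "real \<Rightarrow> real^'n"
  assumes P: "0 \<le> P"
    and z: "continuous_on {0..} z"
    and c: "continuous_on {0..} c" "\<And>i. mono_on {0..} (\<lambda>t. c t $ i)" "\<And>t i. 0 \<le> t \<Longrightarrow> 0 \<le> c t $ i"
    and init: "\<And>i. z 0 $ i = 0 \<Longrightarrow> c 0 $ i = 0"
begin

lemma z_component: "continuous_on {0..} (\<lambda>t. z t $ i)"
  by (intro continuous_intros z)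

lemma input_mono:
  assumes "regulator_path b" shows "mono_on {0..} (\<lambda>s. c s $ i + (P *v b s) $ i)"
proof (rule mono_onI)
  fix s t :: real assume st: "s \<in> {0..}" "t \<in> {0..}" "s \<le> t"
  then have "(P *v b s) $ i \<le> (P *v b t) $ i"
    using assms by (intro matrix_vector_mono P) (auto simp: regulator_path_def mono_on_def)
  then show "c s $ i + (P *v b s) $ i \<le> c t $ i + (P *v b t) $ i"
    using mono_onD[OF c(2) st] by (rule add_mono[rotated])
qed

lemma input_nonneg:
  assumes "regulator_path b" "0 \<le> t" shows "0 \<le> c t $ i + (P *v b t) $ i"
  using mono_onD[OF input_mono[OF assms(1)], of 0 t i] assms c(3)[of 0 i]
  by (simp add: regulator_path_def)

lemma input_right_continuous:
  assumes b: "regulator_path b" and t: "0 \<le> t"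
  shows "continuous (at_right t) (\<lambda>s. c s $ i + (P *v b s) $ i)"
proof -
  have "(b \<longlongrightarrow> b t) (at_right t)" using b t by (simp add: regulator_path_def continuous_within)
  moreover have "(c \<longlongrightarrow> c t) (at_right t)"
    using c(1) t by (auto simp: continuous_on_def intro: tendsto_within_subset)
  ultimately show ?thesis
    unfolding continuous_within matrix_vector_mult_def vec_lambda_beta by (intro tendsto_intros)
qed

lemma excursion_map_regulator_path:
  assumes b: "regulator_path b" shows "regulator_path (excursion_map P z c b)"
proof -
  have "last_zero_value (\<lambda>s. z s $ i) (\<lambda>s. c s $ i + (P *v b s) $ i) 0 = 0" for i
  proof (cases "z 0 $ i = 0")
    case True
    then show ?thesis using init b by (simp add: last_zero_value_at_zero regulator_path_def)
  next
    case False
    then show ?thesis by (simp add: last_zero_value_def)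
  qed
  moreover have "continuous (at_right t) (excursion_map P z c b)" if "0 \<le> t" for t
    using last_zero_value_right_continuous[OF z_component input_right_continuous[OF b] that]
    unfolding excursion_map_def continuous_within by (intro tendsto_vec_lambda)
  moreover have "mono_on {0..} (\<lambda>t. excursion_map P z c b t $ i)" for i
    unfolding excursion_map_def vec_lambda_beta
    by (intro last_zero_value_mono z_component input_mono input_nonneg b)
  ultimately show ?thesis by (simp add: regulator_path_def excursion_map_def vec_eq_iff)
qed

text \<open>
  With \<open>P b\<close> regarded as given, the values of \<open>b\<close> at the zeros of \<open>z\<close> are prescribed, and flatness
  determines the rest; the inequality is then automatic because the input \<open>c + P b\<close> is
  nonnegative and nondecreasing.
\<close>

lemma excursion_problem_iff_fixpoint:
  assumes b: "regulator_path b"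
  shows "excursion_problem P z c b \<longleftrightarrow> (\<forall>t\<ge>0. excursion_map P z c b t = b t)"
proof
  assume ep: "excursion_problem P z c b"
  show "\<forall>t\<ge>0. excursion_map P z c b t = b t"
  proof (intro allI impI)
    fix t :: real assume t: "0 \<le> t"
    have "b t $ i = last_zero_value (\<lambda>s. z s $ i) (\<lambda>s. c s $ i + (P *v b s) $ i) t" for i
      using ep b t unfolding excursion_problem_def regulator_path_def
      by (intro last_zero_value_unique z_component) auto
    then show "excursion_map P z c b t = b t" by (simp add: excursion_map_def vec_eq_iff)
  qed
next
  assume fixed: "\<forall>t\<ge>0. excursion_map P z c b t = b t"
  have eq: "b t $ i = last_zero_value (\<lambda>s. z s $ i) (\<lambda>s. c s $ i + (P *v b s) $ i) t"
    if "0 \<le> t" for t i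
    using arg_cong[OF fixed[rule_format, OF that], of "\<lambda>v. v $ i"] by (simp add: excursion_map_def)
  have "flat_off_zeros (\<lambda>t. z t $ i) (\<lambda>t. b t $ i)" for i
    by (rule flat_off_zeros_cong[THEN iffD1, OF _ _ flat_off_zeros_last_zero_value]) (simp_all add: eq)
  moreover have "b t $ i \<le> c t $ i + (P *v b t) $ i" if "0 \<le> t" for t i
    unfolding eq[OF that, of i]
    by (rule last_zero_value_le[OF z_component input_mono[OF b] input_nonneg[OF b] that])
  moreover have "b t $ i = c t $ i + (P *v b t) $ i" if "0 \<le> t" "z t $ i = 0" for t i
    unfolding eq[OF that(1), of i] using that by (rule last_zero_value_at_zero)
  ultimately show "excursion_problem P z c b" using b by (simp add: excursion_problem_def)
qed

lemma excursion_map_contraction: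
  assumes \<theta>: "(P *v u) $ i \<le> \<theta> * u $ i" "0 \<le> \<theta> * k * u $ i" and k: "0 \<le> k"
    and fg: "\<And>s i. s \<in> {0..t} \<Longrightarrow> \<bar>f s $ i - g s $ i\<bar> \<le> k * u $ i"
  shows "\<bar>excursion_map P z c f t $ i - excursion_map P z c g t $ i\<bar> \<le> \<theta> * k * u $ i"
  unfolding excursion_map_def vec_lambda_beta
proof (rule last_zero_value_nonexpansive[OF z_component _ \<theta>(2)])
  show "\<bar>c s $ i + (P *v f s) $ i - (c s $ i + (P *v g s) $ i)\<bar> \<le> \<theta> * k * u $ i"
    if "s \<in> {0..t}" for s
    using weighted_contraction[OF P \<theta>(1) k fg[OF that]] by simp
qed

lemma excursion_problem_exists:
  assumes "matrix_spectral_radius P < 1"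
  shows "\<exists>b. excursion_problem P z c b"
proof -
  obtain u \<theta> where u: "\<And>i. 0 < u $ i" and \<theta>: "0 \<le> \<theta>" "\<theta> < 1" "\<And>i. (P *v u) $ i \<le> \<theta> * u $ i"
    using exists_contracted_weight[OF P assms] by blast
  have "\<exists>b. regulator_path b \<and> (\<forall>t\<ge>0. excursion_map P z c b t = b t)"
  proof (rule weighted_contraction_fixpoint_exists[OF u \<theta>(1,2)])
    show "regulator_path (\<lambda>_. 0 :: real^'n)" by (simp add: regulator_path_def mono_on_def)
  next
    fix f g :: "real \<Rightarrow> real^'n" and t k i
    assume "0 \<le> (k :: real)" "\<And>s i. s \<in> {0..t} \<Longrightarrow> \<bar>f s $ i - g s $ i\<bar> \<le> k * u $ i"
    then show "\<bar>excursion_map P z c f t $ i - excursion_map P z c g t $ i\<bar> \<le> \<theta> * k * u $ i"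
      using \<theta> u[of i] by (intro excursion_map_contraction) auto
  qed (fact excursion_map_regulator_path regulator_path_bounded regulator_path_uniform_limit)+
  then show ?thesis using excursion_problem_iff_fixpoint by blast
qed

lemma excursion_problem_unique:
  assumes "matrix_spectral_radius P < 1"
    and ep: "excursion_problem P z c b" "excursion_problem P z c b'" and t: "0 \<le> t"
  shows "b t = b' t"
proof -
  obtain u \<theta> where u: "\<And>i. 0 < u $ i" and \<theta>: "0 \<le> \<theta>" "\<theta> < 1" "\<And>i. (P *v u) $ i \<le> \<theta> * u $ i"
    using exists_contracted_weight[OF P assms(1)] by blast
  have reg: "regulator_path b" "regulator_path b'" using ep by (auto simp: excursion_problem_def)
  show ?thesis
  proof (rule weighted_contraction_fixpoint_unique[OF u \<theta>(1,2)
        regulator_path_bounded[OF reg(1)] regulator_path_bounded[OF reg(2)]])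
    show "excursion_map P z c b s = b s" "excursion_map P z c b' s = b' s" if "0 \<le> s" for s
      using ep excursion_problem_iff_fixpoint reg that by blast+
  next
    fix s k i
    assume "0 \<le> (k :: real)" "\<And>r i. r \<in> {0..s} \<Longrightarrow> \<bar>b r $ i - b' r $ i\<bar> \<le> k * u $ i"
    then show "\<bar>excursion_map P z c b s $ i - excursion_map P z c b' s $ i\<bar> \<le> \<theta> * k * u $ i"
      using \<theta> u[of i] by (intro excursion_map_contraction) auto
  qed (fact t)
qed

end

section \<open>The augmented Skorohod problem\<close>

lemma continuous_paths_iff:
  "f \<in> continuous_paths S \<longleftrightarrow>
     f \<in> extensional {0..} \<and> (\<forall>t\<ge>0. f t \<in> S) \<and> continuous_on {0..} f"
  by (auto simp: continuous_paths_def PiE_def)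

lemma cadlag_paths_iff:
  "f \<in> cadlag_paths S \<longleftrightarrow>
     f \<in> extensional {0..} \<and> (\<forall>t\<ge>0. f t \<in> S) \<and>
     (\<forall>t\<ge>0. continuous (at_right t) f) \<and> (\<forall>t>0. \<exists>l. (f \<longlongrightarrow> l) (at_left t))"
  by (auto simp: cadlag_paths_def PiE_def)

lemma regulator_path_columns_iff:
  fixes b :: "real \<Rightarrow> real^'n^'m"
  shows "(\<forall>j. regulator_path (\<lambda>t. column j (b t))) \<longleftrightarrow>
    b 0 = 0 \<and> mono_on {0..} b \<and> (\<forall>t\<ge>0. continuous (at_right t) b)"
proof -
  have "(b \<longlongrightarrow> b t) F \<longleftrightarrow> (\<forall>j. ((\<lambda>s. column j (b s)) \<longlongrightarrow> column j (b t)) F)" for t F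
  proof
    assume "(b \<longlongrightarrow> b t) F"
    then show "\<forall>j. ((\<lambda>s. column j (b s)) \<longlongrightarrow> column j (b t)) F"
      unfolding column_def by (intro allI tendsto_intros)
  next
    assume col: "\<forall>j. ((\<lambda>s. column j (b s)) \<longlongrightarrow> column j (b t)) F"
    have "((\<lambda>s. b s $ i $ j) \<longlongrightarrow> b t $ i $ j) F" for i j
      using tendsto_vec_nth[OF col[rule_format, of j], of i] by (simp add: column_def)
    then show "(b \<longlongrightarrow> b t) F" by (intro vec_tendstoI)
  qed
  then show ?thesis
    unfolding regulator_path_def continuous_within
    by (auto simp: column_def vec_eq_iff mono_on_def less_eq_vec_def)
qed

lemma monotone_left_limit:
  fixes w :: "real \<Rightarrow> real"
  assumes w: "mono_on {0..} w" and t: "0 < t"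
  shows "\<exists>l. (w \<longlongrightarrow> l) (at_left t)"
proof -
  have bdd: "bdd_above (w ` {0..<t})"
    using w t by (intro bdd_aboveI[of _ "w t"]) (auto simp: mono_on_def)
  have "(w \<longlongrightarrow> (SUP s\<in>{0..<t}. w s)) (at_left t)"
  proof (rule order_tendstoI)
    fix a assume "a < (SUP s\<in>{0..<t}. w s)"
    then obtain s where s: "s \<in> {0..<t}" "a < w s"
      using t bdd by (subst (asm) less_cSUP_iff) auto
    have "\<forall>\<^sub>F r in at_left t. s < r \<and> r < t"
      using s by (intro eventually_conj) (auto simp: eventually_at_left_field intro: exI[of _ s])
    then show "\<forall>\<^sub>F r in at_left t. a < w r"
    proof eventually_elim
      case (elim r)
      then show ?case using mono_onD[OF w, of s r] s by simp
    qed
  next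
    fix a assume a: "(SUP s\<in>{0..<t}. w s) < a"
    have "\<forall>\<^sub>F r in at_left t. 0 < r \<and> r < t"
      using t by (intro eventually_conj) (auto simp: eventually_at_left_field intro: exI[of _ 0])
    then show "\<forall>\<^sub>F r in at_left t. w r < a"
    proof eventually_elim
      case (elim r)
      then have "w r \<le> (SUP s\<in>{0..<t}. w s)" by (intro cSUP_upper bdd) auto
      then show ?case using a by simp
    qed
  qed
  then show ?thesis ..
qed

lemma mono_matrix_left_limit:
  fixes b :: "real \<Rightarrow> real^'n^'m"
  assumes b: "mono_on {0..} b" and t: "0 < t"
  shows "\<exists>l. (b \<longlongrightarrow> l) (at_left t)"
proof -
  have "\<exists>l. ((\<lambda>s. b s $ i $ j) \<longlongrightarrow> l) (at_left t)" for i j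
    using b t by (intro monotone_left_limit) (auto simp: mono_on_def less_eq_vec_def)
  then obtain l where l: "\<And>i j. ((\<lambda>s. b s $ i $ j) \<longlongrightarrow> l i j) (at_left t)" by metis
  have "(b \<longlongrightarrow> (\<chi> i j. l i j)) (at_left t)"
    by (intro vec_tendstoI) (simp add: l)
  then show ?thesis ..
qed

lemma column_matrix_mult: "A *v column j B = column j (A ** B)"
  by (simp add: matrix_vector_mult_def matrix_matrix_mult_def column_def)

lemma tendsto_affine_matrix:
  fixes c b :: "'a \<Rightarrow> real^'n^'n"
  assumes "(c \<longlongrightarrow> lc) F" "(b \<longlongrightarrow> lb) F"
  shows "((\<lambda>t. c t - A ** b t) \<longlongrightarrow> lc - A ** lb) F"
  unfolding matrix_matrix_mult_def by (intro tendsto_intros assms)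

text \<open>
  The problem is triangular: \<open>y\<close> solves a problem of its own, it determines \<open>z\<close>, and given
  \<open>z\<close> the columns of \<open>b\<close> solve separate problems and determine \<open>a\<close>. The left limits of \<open>a\<close> and
  \<open>b\<close> come for free from monotonicity of \<open>b\<close> and continuity of \<open>\<chi>\<close>.
\<close>

lemma augmented_skorohod_iff:
  fixes P P' :: "real^'n^'n"
  assumes x: "x \<in> continuous_paths UNIV" and chi: "chi \<in> continuous_paths UNIV"
  shows "augmented_skorohod (mat 1 - P) (mat 1 - P') x chi (z, y, a, b) \<longleftrightarrow>
    y \<in> extensional {0..} \<and> skorohod_problem P x y \<and>
    z = (\<lambda>t\<in>{0..}. x t + (mat 1 - P) *v y t) \<and>
    b \<in> extensional {0..} \<and>
    (\<forall>j. excursion_problem P' z (\<lambda>t. column j (chi t)) (\<lambda>t. column j (b t))) \<and>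
    a = (\<lambda>t\<in>{0..}. chi t - (mat 1 - P') ** b t)"
    (is "?aug \<longleftrightarrow> ?split")
proof -
  have z_eq: "(x t + (mat 1 - P) *v y t) $ i = x t $ i - (P *v y t) $ i + y t $ i" for t i
    by (simp add: matrix_vector_mult_diff_rdistrib)
  have sub_mult: "(mat 1 - P') ** B = B - P' ** B" for B :: "real^'n^'n"
    by (simp add: matrix_eq matrix_vector_mul_assoc[symmetric] matrix_vector_mult_diff_rdistrib)
  have a_eq: "(chi t - (mat 1 - P') ** b t) $ i $ j
      = column j (chi t) $ i + (P' *v column j (b t)) $ i - column j (b t) $ i" for t i j
    by (simp add: column_matrix_mult) (simp add: column_def sub_mult)
  show ?thesis
  proof
    assume ?aug
    note sol = this[unfolded augmented_skorohod_def prod.case continuous_paths_iff cadlag_paths_iff]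
    have zt: "z t $ i = x t $ i - (P *v y t) $ i + y t $ i" if "0 \<le> t" for t i
      using sol that by (simp add: z_eq[symmetric])
    have at: "a t $ i $ j
      = column j (chi t) $ i + (P' *v column j (b t)) $ i - column j (b t) $ i" if "0 \<le> t" for t i j
      using sol that by (simp add: a_eq[symmetric])
    have z: "continuous_on {0..} z" and znn: "\<And>t i. 0 \<le> t \<Longrightarrow> 0 \<le> z t $ i"
      using sol by (auto simp: less_eq_vec_def)
    have y: "continuous_on {0..} y" "\<And>i. mono_on {0..} (\<lambda>t. y t $ i)"
      using sol by (auto simp: mono_on_def less_eq_vec_def)
    have y_right: "continuous (at_right t) y" if "0 \<le> t" for t
      using y(1) that by (auto simp: continuous_on_def continuous_within intro: tendsto_within_subset)
    have flat_y: "flat_off_zeros (\<lambda>t. z t $ i) (\<lambda>t. y t $ i)" for i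
      using sol stieltjes_integral_eq_0_iff[OF z znn y(2) y_right] by blast
    have "skorohod_problem P x y"
      unfolding skorohod_problem_def
    proof (intro conjI allI impI y)
      show "y 0 = 0" using sol by blast
      show "0 \<le> x t $ i - (P *v y t) $ i + y t $ i" if "0 \<le> t" for t i
        using znn[OF that, of i] zt[OF that] by simp
      show "flat_off_zeros (\<lambda>t. x t $ i - (P *v y t) $ i + y t $ i) (\<lambda>t. y t $ i)" for i
        using flat_off_zeros_cong[THEN iffD1, OF _ _ flat_y[of i]] zt by simp
    qed
    moreover have reg: "regulator_path (\<lambda>t. column j (b t))" for j
      using sol regulator_path_columns_iff[of b] by blast
    have "excursion_problem P' z (\<lambda>t. column j (chi t)) (\<lambda>t. column j (b t))" for j
      unfolding excursion_problem_def
    proof (intro conjI allI impI reg)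
      have "stieltjes_integral z (\<lambda>t. column j (b t)) = 0" using sol by blast
      then show "flat_off_zeros (\<lambda>t. z t $ i) (\<lambda>t. column j (b t) $ i)" for i
        using stieltjes_integral_eq_0_iff[OF z znn regulator_pathD[OF reg]] by blast
      have nn: "0 \<le> a t $ i $ j" if "0 \<le> t" for t i
        using sol that by (auto simp: less_eq_vec_def)
      show "column j (b t) $ i \<le> column j (chi t) $ i + (P' *v column j (b t)) $ i" if "0 \<le> t" for t i
        using nn[OF that, of i] at[OF that, of i j] by simp
      show "column j (b t) $ i = column j (chi t) $ i + (P' *v column j (b t)) $ i"
        if "0 \<le> t" "z t $ i = 0" for t i
      proof -
        have "row i (a t) = 0" using sol that by blast
        then have "a t $ i $ j = 0" by (simp add: row_def vec_eq_iff)
        then show ?thesis using at[OF that(1), of i j] by simp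
      qed
    qed
    moreover have "z = (\<lambda>t\<in>{0..}. x t + (mat 1 - P) *v y t)"
      "a = (\<lambda>t\<in>{0..}. chi t - (mat 1 - P') ** b t)"
      using sol by (auto intro!: extensionalityI[of _ "{0..}"])
    ultimately show ?split using sol by blast
  next
    assume split: ?split
    then have sp: "skorohod_problem P x y"
      and ep: "\<And>j. excursion_problem P' z (\<lambda>t. column j (chi t)) (\<lambda>t. column j (b t))"
      and z_def: "z = (\<lambda>t\<in>{0..}. x t + (mat 1 - P) *v y t)"
      and a_def: "a = (\<lambda>t\<in>{0..}. chi t - (mat 1 - P') ** b t)"
      and ext: "y \<in> extensional {0..}" "b \<in> extensional {0..}" by blast+
    have xc: "continuous_on {0..} x" and cc: "continuous_on {0..} chi"
      using x chi by (auto simp: continuous_paths_iff)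
    have y: "continuous_on {0..} y" "y 0 = 0" "\<And>i. mono_on {0..} (\<lambda>t. y t $ i)"
      using sp by (auto simp: skorohod_problem_def)
    have y_right: "continuous (at_right t) y" if "0 \<le> t" for t
      using y(1) that by (auto simp: continuous_on_def continuous_within intro: tendsto_within_subset)
    have zt: "z t $ i = x t $ i - (P *v y t) $ i + y t $ i" if "0 \<le> t" for t i
      using that by (simp add: z_def z_eq[symmetric])
    have at: "a t $ i $ j
      = column j (chi t) $ i + (P' *v column j (b t)) $ i - column j (b t) $ i" if "0 \<le> t" for t i j
      using that by (simp add: a_def a_eq[symmetric])
    have "continuous_on {0..} (\<lambda>t. x t + (mat 1 - P) *v y t)"
      unfolding matrix_vector_mult_def by (intro continuous_intros xc y)
    then have z: "continuous_on {0..} z"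
      by (rule continuous_on_eq) (simp add: z_def)
    have znn: "0 \<le> z t $ i" if "0 \<le> t" for t i
      using sp that zt by (simp add: skorohod_problem_def)
    have "flat_off_zeros (\<lambda>t. z t $ i) (\<lambda>t. y t $ i)" for i
      using sp zt flat_off_zeros_cong[of "\<lambda>t. z t $ i"] unfolding skorohod_problem_def by simp
    then have int_y: "stieltjes_integral z y = 0"
      using stieltjes_integral_eq_0_iff[OF z znn y(3) y_right] by blast
    have reg: "regulator_path (\<lambda>t. column j (b t))" for j
      using ep by (simp add: excursion_problem_def)
    then have b: "b 0 = 0" "mono_on {0..} b" "\<And>t. 0 \<le> t \<Longrightarrow> continuous (at_right t) b"
      using regulator_path_columns_iff[of b] by blast+
    have int_b: "stieltjes_integral z (\<lambda>t. column j (b t)) = 0" for j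
      using stieltjes_integral_eq_0_iff[OF z znn regulator_pathD[OF reg]] ep
      unfolding excursion_problem_def by blast
    have b_nn: "0 \<le> b t" if "0 \<le> t" for t
      using mono_onD[OF b(2), of 0 t] b(1) that by simp
    have y_nn: "0 \<le> y t" if "0 \<le> t" for t
      using mono_onD[OF y(3), of 0 t] y(2) that by (simp add: less_eq_vec_def)
    have a_right: "continuous (at_right t) a" if t: "0 \<le> t" for t
    proof -
      have "(chi \<longlongrightarrow> chi t) (at_right t)"
        using cc t by (auto simp: continuous_on_def intro: tendsto_within_subset)
      then have "((\<lambda>t. chi t - (mat 1 - P') ** b t) \<longlongrightarrow> a t) (at_right t)"
        using tendsto_affine_matrix[OF _ b(3)[OF t, unfolded continuous_within]] t by (simp add: a_def)
      moreover have "\<forall>\<^sub>F s in at_right t. chi s - (mat 1 - P') ** b s = a s"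
        using t by (auto simp: a_def eventually_at_right_field intro!: exI[of _ "t + 1"])
      ultimately show ?thesis unfolding continuous_within by (rule Lim_transform_eventually)
    qed
    have a_left: "\<exists>l. (a \<longlongrightarrow> l) (at_left t)" if t: "0 < t" for t
    proof -
      obtain l where l: "(b \<longlongrightarrow> l) (at_left t)" using mono_matrix_left_limit[OF b(2) t] by blast
      have "(chi \<longlongrightarrow> chi t) (at t within {0..<t})"
        by (rule tendsto_within_subset[where S = "{0..}"]) (use cc t in \<open>auto simp: continuous_on_def\<close>)
      moreover have "at t within {0..<t} = at_left t"
        using t by (intro at_within_nhd[of t "{0<..}"]) auto
      ultimately have "((\<lambda>t. chi t - (mat 1 - P') ** b t) \<longlongrightarrow> chi t - (mat 1 - P') ** l) (at_left t)"
        by (intro tendsto_affine_matrix l) simp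
      moreover have "\<forall>\<^sub>F s in at_left t. chi s - (mat 1 - P') ** b s = a s"
        using t by (auto simp: a_def eventually_at_left_field intro!: exI[of _ 0])
      ultimately have "(a \<longlongrightarrow> chi t - (mat 1 - P') ** l) (at_left t)" by (rule Lim_transform_eventually)
      then show ?thesis ..
    qed
    have a_nn: "0 \<le> a t" if "0 \<le> t" for t
      using at[OF that] ep that by (simp add: less_eq_vec_def excursion_problem_def)
    have a_row: "row i (a t) = 0" if "0 \<le> t" "z t $ i = 0" for t i
      using at[OF that(1)] ep that by (simp add: row_def vec_eq_iff excursion_problem_def)
    have z_nn: "0 \<le> z t" if "0 \<le> t" for t using znn that by (simp add: less_eq_vec_def)
    have y_mono: "mono_on {0..} y" using y(3) by (simp add: mono_on_def less_eq_vec_def)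
    have z_ext: "z \<in> extensional {0..}" and a_ext: "a \<in> extensional {0..}"
      by (simp_all add: z_def a_def)
    have z_split: "z t = x t + (mat 1 - P) *v y t"
      and a_split: "a t = chi t - (mat 1 - P') ** b t" if "0 \<le> t" for t
      using that by (simp_all add: z_def a_def)
    show ?aug
      unfolding augmented_skorohod_def prod.case continuous_paths_iff cadlag_paths_iff
      by (intro conjI allI impI; (simp only: atLeast_iff)?;
          (rule ext z_ext a_ext z y(1,2) y_mono y_nn z_nn int_y int_b b b_nn a_nn a_row a_right
            a_left mono_matrix_left_limit[OF b(2)] z_split a_split; assumption?))
  qed
qed

theorem mainTheorem3:
  fixes P P' R R' :: "real^'n^'n"
    and x :: "real \<Rightarrow> real^'n" and chi :: "real \<Rightarrow> real^'n^'n"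
  assumes "0 \<le> P" and "matrix_spectral_radius P < 1" and "\<And>i. P $ i $ i = 0"
    and "0 \<le> P'" and "matrix_spectral_radius P' < 1" and "\<And>i. P' $ i $ i = 0"
    and "R = mat 1 - P" and "R' = mat 1 - P'"
    and "x \<in> continuous_paths UNIV" and "chi \<in> continuous_paths UNIV"
    and "\<And>t. t \<ge> 0 \<Longrightarrow> 0 \<le> chi t" and "mono_on {0..} chi"
    and "0 \<le> x 0" and "\<And>i. x 0 $ i = 0 \<Longrightarrow> row i (chi 0) = 0"
  shows "\<exists>!s. augmented_skorohod R R' x chi s"
proof -
  have x: "continuous_on {0..} x" and chi: "continuous_on {0..} chi"
    using assms(9,10) by (auto simp: continuous_paths_iff)
  note iff = augmented_skorohod_iff[OF assms(9,10), of P P', folded assms(7,8)]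
  obtain y' where y': "skorohod_problem P x y'"
    using skorohod_problem_exists[OF assms(1,2) x assms(13)] by blast
  define y where "y = restrict y' {0..}"
  have y: "skorohod_problem P x y"
    by (rule skorohod_problem_cong[OF y']) (simp add: y_def)
  have y_unique: "w = y" if "w \<in> extensional {0..}" "skorohod_problem P x w" for w
    using skorohod_problem_unique[OF assms(1,2) x that(2) y] that(1)
    by (intro extensionalityI[of _ "{0..}"]) (auto simp: y_def)
  define z where "z = (\<lambda>t\<in>{0..}. x t + R *v y t)"
  have data: "excursion_data P' z (\<lambda>t. column j (chi t))" for j
  proof
    have "continuous_on {0..} (\<lambda>t. x t + R *v y t)"
      using y unfolding matrix_vector_mult_def skorohod_problem_def by (intro continuous_intros x) auto
    then show "continuous_on {0..} z" by (rule continuous_on_eq) (simp add: z_def)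
    show "continuous_on {0..} (\<lambda>t. column j (chi t))"
      unfolding column_def by (intro continuous_intros chi)
    show "mono_on {0..} (\<lambda>t. column j (chi t) $ i)" for i
      using assms(12) by (simp add: mono_on_def less_eq_vec_def column_def)
    show "0 \<le> column j (chi t) $ i" if "0 \<le> t" for t i
      using assms(11)[OF that] by (simp add: less_eq_vec_def column_def)
    have "y 0 = 0" using y by (simp add: skorohod_problem_def)
    then have "z 0 = x 0" by (simp add: z_def)
    then show "column j (chi 0) $ i = 0" if "z 0 $ i = 0" for i
      using that assms(14)[of i] by (simp add: row_def column_def vec_eq_iff)
  qed (rule assms(4))
  have "\<exists>b'. \<forall>j. excursion_problem P' z (\<lambda>t. column j (chi t)) (b' j)"
    using excursion_data.excursion_problem_exists[OF data assms(5)] by metis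
  then obtain b' where b': "\<And>j. excursion_problem P' z (\<lambda>t. column j (chi t)) (b' j)" by blast
  define b where "b = (\<lambda>t\<in>{0..}. \<chi> i j. b' j t $ i)"
  have b: "excursion_problem P' z (\<lambda>t. column j (chi t)) (\<lambda>t. column j (b t))" for j
    by (rule excursion_problem_cong[OF b'[of j]]) (simp add: b_def column_def vec_eq_iff)
  have b_unique: "w = b" if "w \<in> extensional {0..}"
    and "\<And>j. excursion_problem P' z (\<lambda>t. column j (chi t)) (\<lambda>t. column j (w t))" for w
  proof (rule extensionalityI[of _ "{0..}"])
    show "w t = b t" if "t \<in> {0..}" for t
    proof -
      have "column j (w t) = column j (b t)" for j
        using excursion_data.excursion_problem_unique[OF data assms(5) _ b]
          \<open>\<And>j. excursion_problem P' z (\<lambda>t. column j (chi t)) (\<lambda>t. column j (w t))\<close> that by auto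
      then show ?thesis by (simp add: column_def vec_eq_iff)
    qed
  qed (use that in \<open>auto simp: b_def\<close>)
  show ?thesis
  proof (rule ex1I)
    show "augmented_skorohod R R' x chi (z, y, (\<lambda>t\<in>{0..}. chi t - R' ** b t), b)"
      using y b by (simp add: iff z_def y_def b_def)
    show "s = (z, y, (\<lambda>t\<in>{0..}. chi t - R' ** b t), b)" if "augmented_skorohod R R' x chi s" for s
    proof -
      obtain z1 y1 a1 b1 where s: "s = (z1, y1, a1, b1)" by (cases s) auto
      note split = that[unfolded s iff]
      have "y1 = y" using split by (intro y_unique) auto
      moreover from this have "z1 = z" using split by (simp add: z_def)
      moreover from this have "b1 = b" using split by (intro b_unique) auto
      ultimately show ?thesis using split s by simp
    qed
  qed
qed

end
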